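(* Let $M$ be a formal Bishop surface with an elliptic complex tangent at $0$, whose Bishop invariant $\lambda$ is $0$ and whose Moser invariant $s$ is a finite integer greater than two. Then there exists a formal transformation $$(z',w')=F(z,w)=(\tilde f(z,w),\tilde g(z,w)),\qquad F(0,0)=(0,0),$$ such that in the $(z',w')$ coordinates $M'=F(M)$ is represented near the origin by a formal equation of the following normal form: $$w'=z'\overline{z'}+z'^s+\overline{z'}^s+\varphi(z')+\overline{\varphi(z')},\qquad \varphi(z')=\sum_{k=1}^{\infty}\sum_{j=2}^{s-1}a_{ks+j}z'^{\,ks+j},\quad a_{ks+j}\in\mathbb C.$$ Such a formal transformation is unique up to composition from the left with a rotation of the form $z''=e^{i\theta}z'$, $w''=w'$, where $\theta$ is a (real) constant with $e^{is\theta}=1$.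
   Context: Coordinates on $\mathbb C^2$ are $(z,w)$. A formal (real) surface with a complex tangent at $0$ is one which, after a complex linear change of coordinates, is given by a formal equation $w=H(z,\bar z)$ with $H\in\mathbb C[[z,\bar z]]$ having no terms of degree less than $2$. A formal transformation (preserving the origin) is a pair $F=(F_1,F_2)$ of formal power series in $(z,w)$ without constant term whose Jacobian matrix at $0$ is invertible. It maps $M=\{w=H(z,\bar z)\}$ to $M'=\{w'=H'(z',\overline{z'})\}$ (written $F(M)=M'$) if substituting $w=H(z,\bar z)$ gives $F_2(z,w)=H'\big(F_1(z,w),\overline{F_1(z,w)}\big)$ identically as formal power series in $(z,\bar z)$. The surface is a (formal) Bishop surface at $0$ if the complex tangent is non-degenerate, i.e. there is no change of coordinates in which it is given by $w=O(|z|^3)$. It has Bishop invariant $\lambda=0$ (a special case of an elliptic complex tangent) if in suitable coordinates it is given by $w=z\bar z+O(|z|^3)$. In that case it has finite Moser invariant $s$ ($3\le s<\infty$ an integer) if in suitable formal coordinates it is given by $w=z\bar z+z^s+\bar z^s+E(z,\bar z)$, where all terms of the formal power series $E$ have degree at least $s+1$; $s$ is a formal invariant. *)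

theory Defs
  imports Complex_Main "HOL-Computational_Algebra.Formal_Power_Series"
begin

unbundle fps_syntax

text \<open>
  A formal power series in two variables is an element of \<open>complex fps fps\<close>; \<open>A $ i $ j\<close> is the
  coefficient of \<open>x\<^sup>i y\<^sup>j\<close>. The pair \<open>(x, y)\<close> is \<open>(z, w)\<close> for the components of a transformation
  and \<open>(z, \<zeta>)\<close>, with \<open>\<zeta>\<close> standing for the conjugate of \<open>z\<close>, for the right-hand side of the
  equation of a surface.
\<close>

type_synonym series2 = "complex fps fps"

definition var1 :: series2 where
  "var1 = fps_X"

definition var2 :: series2 where
  "var2 = fps_const fps_X"

definition const2 :: "complex \<Rightarrow> series2" where
  "const2 c = fps_const (fps_const c)"

definition terms_degree_ge :: "nat \<Rightarrow> series2 \<Rightarrow> bool" where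
  "terms_degree_ge d A \<longleftrightarrow> (\<forall>i j. i + j < d \<longrightarrow> A $ i $ j = 0)"

text \<open>
  Substitution \<open>A(P, Q)\<close>, to be used only for \<open>P\<close>, \<open>Q\<close> without constant term: then
  \<open>P\<^sup>i Q\<^sup>j\<close> has no terms of degree less than \<open>i + j\<close> (lemma \<open>subst2_cutoff\<close> below), so the
  finite sum is the full coefficient of the infinite sum of the \<open>A\<^sub>i\<^sub>j P\<^sup>i Q\<^sup>j\<close>.
\<close>

definition subst2 :: "series2 \<Rightarrow> series2 \<Rightarrow> series2 \<Rightarrow> series2" where
  "subst2 A P Q =
     Abs_fps (\<lambda>m. Abs_fps (\<lambda>n. \<Sum>i\<le>m + n. \<Sum>j\<le>m + n. A $ i $ j * (P ^ i * Q ^ j) $ m $ n))"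

lemma terms_degree_ge_mult:
  assumes "terms_degree_ge d A" "terms_degree_ge e B"
  shows "terms_degree_ge (d + e) (A * B)"
  unfolding terms_degree_ge_def
proof (intro allI impI)
  fix m n :: nat
  assume mn: "m + n < d + e"
  have "A $ k $ l * B $ (m - k) $ (n - l) = 0" if "k \<le> m" "l \<le> n" for k l
  proof (cases "k + l < d")
    case True
    then show ?thesis using assms(1) by (simp add: terms_degree_ge_def)
  next
    case False
    then have "(m - k) + (n - l) < e" using mn that by linarith
    then show ?thesis using assms(2) by (simp add: terms_degree_ge_def)
  qed
  then show "(A * B) $ m $ n = 0"
    by (auto simp: fps_mult_nth fps_sum_nth intro!: sum.neutral)
qed

lemma terms_degree_ge_power:
  assumes "terms_degree_ge 1 A"
  shows "terms_degree_ge k (A ^ k)"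
proof (induction k)
  case 0
  then show ?case by (simp add: terms_degree_ge_def)
next
  case (Suc k)
  then show ?case using terms_degree_ge_mult[OF assms Suc] by simp
qed

lemma subst2_cutoff:
  assumes "P $ 0 $ 0 = 0" "Q $ 0 $ 0 = 0" "m + n < i + j"
  shows "(P ^ i * Q ^ j :: series2) $ m $ n = 0"
proof -
  have "terms_degree_ge 1 P" "terms_degree_ge 1 Q"
    using assms(1,2) by (auto simp: terms_degree_ge_def)
  then have "terms_degree_ge (i + j) (P ^ i * Q ^ j)"
    by (intro terms_degree_ge_mult terms_degree_ge_power)
  then show ?thesis using assms(3) by (auto simp: terms_degree_ge_def)
qed

text \<open>
  Complex conjugate of a series in \<open>z\<close> and its conjugate: the coefficients are conjugated and the
  two variables exchanged.
\<close>

definition conj2 :: "series2 \<Rightarrow> series2" where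
  "conj2 A = Abs_fps (\<lambda>i. Abs_fps (\<lambda>j. cnj (A $ j $ i)))"

definition of_first :: "complex fps \<Rightarrow> series2" where
  "of_first \<phi> = Abs_fps (\<lambda>i. fps_const (\<phi> $ i))"

type_synonym formal_map = "series2 \<times> series2"

definition formal_transformation :: "formal_map \<Rightarrow> bool" where
  "formal_transformation F \<longleftrightarrow>
     fst F $ 0 $ 0 = 0 \<and> snd F $ 0 $ 0 = 0 \<and>
     fst F $ 1 $ 0 * snd F $ 0 $ 1 - fst F $ 0 $ 1 * snd F $ 1 $ 0 \<noteq> 0"

definition linear_transformation :: "formal_map \<Rightarrow> bool" where
  "linear_transformation F \<longleftrightarrow> formal_transformation F \<and>
     (\<forall>i j. i + j \<noteq> 1 \<longrightarrow> fst F $ i $ j = 0 \<and> snd F $ i $ j = 0)"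

definition map_compose :: "formal_map \<Rightarrow> formal_map \<Rightarrow> formal_map" where
  "map_compose G F = (subst2 (fst G) (fst F) (snd F), subst2 (snd G) (fst F) (snd F))"

definition rotation :: "real \<Rightarrow> formal_map" where
  "rotation \<theta> = (const2 (exp (\<i> * of_real \<theta>)) * var1, var2)"

text \<open>
  \<open>F\<close> maps \<open>{w = H}\<close> to \<open>{w' = H'}\<close>: both sides are series in \<open>z\<close> and its conjugate, obtained by
  substituting \<open>w = H\<close> in \<open>F\<^sub>2 = H'(F\<^sub>1, conjugate of F\<^sub>1)\<close>.
\<close>

definition maps_graph :: "formal_map \<Rightarrow> series2 \<Rightarrow> series2 \<Rightarrow> bool" where
  "maps_graph F H H' \<longleftrightarrow>
     subst2 (snd F) var1 H =
     subst2 H' (subst2 (fst F) var1 H) (conj2 (subst2 (fst F) var1 H))"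

text \<open>
  A surface with a complex tangent at the origin is a graph \<open>w = H\<close> only after a linear change of
  coordinates. The pair \<open>(L, H)\<close> stands for the surface \<open>L({w = H})\<close>; a surface already in graph
  form is \<open>((var1, var2), H)\<close>.
\<close>

type_synonym surface = "formal_map \<times> series2"

definition formal_surface :: "surface \<Rightarrow> bool" where
  "formal_surface M \<longleftrightarrow> linear_transformation (fst M) \<and> terms_degree_ge 2 (snd M)"

text \<open>
  \<open>F(M) = {w' = H'}\<close>, i.e. \<open>M\<close> is given by \<open>w' = H'\<close> in the coordinates \<open>(z', w') = F(z, w)\<close>.
\<close>

definition given_by :: "formal_map \<Rightarrow> surface \<Rightarrow> series2 \<Rightarrow> bool" where
  "given_by F M H' \<longleftrightarrow> maps_graph (map_compose F (fst M)) (snd M) H'"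

definition bishop_surface :: "surface \<Rightarrow> bool" where
  "bishop_surface M \<longleftrightarrow> formal_surface M \<and>
     \<not> (\<exists>F H'. formal_transformation F \<and> terms_degree_ge 3 H' \<and> given_by F M H')"

definition bishop_invariant_zero :: "surface \<Rightarrow> bool" where
  "bishop_invariant_zero M \<longleftrightarrow>
     (\<exists>F E. formal_transformation F \<and> terms_degree_ge 3 E \<and>
        given_by F M (var1 * var2 + E))"

definition moser_invariant :: "surface \<Rightarrow> nat \<Rightarrow> bool" where
  "moser_invariant M s \<longleftrightarrow> 3 \<le> s \<and>
     (\<exists>F E. formal_transformation F \<and> terms_degree_ge (s + 1) E \<and>
        given_by F M (var1 * var2 + var1 ^ s + var2 ^ s + E))"

definition normal_form_phi :: "nat \<Rightarrow> (nat \<Rightarrow> complex) \<Rightarrow> complex fps" where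
  "normal_form_phi s a =
     Abs_fps (\<lambda>n. if \<exists>k j. 1 \<le> k \<and> 2 \<le> j \<and> j \<le> s - 1 \<and> n = k * s + j then a n else 0)"

definition normal_form :: "nat \<Rightarrow> (nat \<Rightarrow> complex) \<Rightarrow> series2" where
  "normal_form s a = var1 * var2 + var1 ^ s + var2 ^ s +
     of_first (normal_form_phi s a) + conj2 (of_first (normal_form_phi s a))"

definition normalizing :: "surface \<Rightarrow> nat \<Rightarrow> formal_map \<Rightarrow> bool" where
  "normalizing M s F \<longleftrightarrow> formal_transformation F \<and> (\<exists>a. given_by F M (normal_form s a))"

end

theory Submission
  imports Defs
begin

text \<open>
  Give \<open>z\<close> and \<open>\<zeta>\<close> (the conjugate of \<open>z\<close>) weight \<open>1\<close>, and let the product \<open>z \<zeta>\<close> have weight \<open>s\<close>, so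
  that \<open>z \<zeta> + z\<^sup>s + \<zeta>\<^sup>s\<close> is homogeneous and \<open>w\<close> has weight \<open>s\<close>. Since \<open>z \<zeta> = w - z\<^sup>s - \<zeta>\<^sup>s\<close> modulo
  higher weight, every series splits, in each weight, into a series in \<open>(z, w)\<close> and one in
  \<open>(\<zeta>, w)\<close>. If two transformations tangent to the identity, together with their normal forms, agree
  below weight \<open>N\<close>, the difference of their equations is, in weight \<open>N\<close>, a linear function of the
  difference of the data. The component in \<open>(z, w)\<close> determines \<open>g\<close>; the component in \<open>(\<zeta>, w)\<close> gives a
  bidiagonal system for the coefficients of \<open>f\<close> and \<open>\<phi>\<close> whose diagonal entries are \<open>1\<close> and \<open>s - 1\<close>. It has
  one more equation than unknowns from \<open>f\<close> if \<open>N\<close> is not congruent to \<open>0\<close> or \<open>1\<close> modulo \<open>s\<close>, which is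
  where \<open>\<phi>\<close> has a coefficient, and it is uniquely solvable by \<open>f\<close> alone otherwise. Hence the normalization
  tangent to the identity exists and is unique, weight by weight; the first jet of an arbitrary one is
  a rotation by an \<open>s\<close>-th root of unity.
\<close>

section \<open>Substitution into formal power series\<close>

lemma series2_eqI: "(\<And>i j. A $ i $ j = B $ i $ j) \<Longrightarrow> A = (B :: series2)"
  by (simp add: fps_eq_iff)

lemma var1_nth: "var1 $ i $ j = (if i = 1 \<and> j = 0 then 1 else 0)"
  by (simp add: var1_def fps_X_def)

lemma var2_nth: "var2 $ i $ j = (if i = 0 \<and> j = 1 then 1 else 0)"
  by (simp add: var2_def fps_X_def)

lemma var1_nth_00 [simp]: "var1 $ 0 $ 0 = 0" and var2_nth_00 [simp]: "var2 $ 0 $ 0 = 0"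
  by (simp_all add: var1_nth var2_nth)

lemma const2_nth: "const2 c $ i $ j = (if i = 0 \<and> j = 0 then c else 0)"
  by (simp add: const2_def)

lemma const2_simps [simp]:
  "const2 0 = 0" "const2 1 = 1" "const2 (c + d) = const2 c + const2 d"
  "const2 (c * d) = const2 c * const2 d" "const2 (c - d) = const2 c - const2 d"
  "const2 (- c) = - const2 c" "const2 (c ^ n) = const2 c ^ n"
  by (simp_all add: const2_def flip: fps_const_power)

lemma const2_mult_nth [simp]: "(const2 c * A) $ i $ j = c * A $ i $ j"
  by (simp add: const2_def)

lemma var1_power_mult_nth: "(var1 ^ k * A) $ i $ j = (if i < k then 0 else A $ (i - k) $ j)"
  by (simp add: var1_def fps_X_power_mult_nth)

lemma var2_power_mult_nth: "(var2 ^ k * A) $ i $ j = (if j < k then 0 else A $ i $ (j - k))"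
  by (simp add: var2_def fps_const_power fps_X_power_mult_nth)

lemma var1_mult_nth: "(var1 * A) $ i $ j = (if i = 0 then 0 else A $ (i - 1) $ j)"
  using var1_power_mult_nth[of 1 A i j] by simp

lemma var2_mult_nth: "(var2 * A) $ i $ j = (if j = 0 then 0 else A $ i $ (j - 1))"
  using var2_power_mult_nth[of 1 A i j] by simp

lemma monomial_nth:
  "(const2 c * var1 ^ k * var2 ^ l) $ i $ j = (if i = k \<and> j = l then c else 0)"
proof -
  have "const2 c * var1 ^ k * var2 ^ l = var1 ^ k * (var2 ^ l * const2 c)"
    by (simp add: ac_simps)
  then show ?thesis
    by (simp only: var1_power_mult_nth var2_power_mult_nth const2_nth) auto
qed

section \<open>Orders of vanishing with respect to a weight on monomials\<close>

definition weight_ge :: "(nat \<Rightarrow> nat \<Rightarrow> nat) \<Rightarrow> nat \<Rightarrow> series2 \<Rightarrow> bool" where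
  "weight_ge \<omega> N A \<longleftrightarrow> (\<forall>i j. \<omega> i j < N \<longrightarrow> A $ i $ j = 0)"

text \<open>Only an inequality holds for \<open>surface_weight\<close>: the product of the two
  variables has weight \<open>s\<close>, more than the sum of their weights. The inequality is what
  makes orders add under multiplication.\<close>

definition superadditive :: "(nat \<Rightarrow> nat \<Rightarrow> nat) \<Rightarrow> bool" where
  "superadditive \<omega> \<longleftrightarrow> (\<forall>i j k l. \<omega> i j + \<omega> k l \<le> \<omega> (i + k) (j + l))"

lemma weight_geD: "weight_ge \<omega> N A \<Longrightarrow> \<omega> i j < N \<Longrightarrow> A $ i $ j = 0"
  by (simp add: weight_ge_def)

lemma weight_ge_mono: "weight_ge \<omega> N A \<Longrightarrow> M \<le> N \<Longrightarrow> weight_ge \<omega> M A"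
  by (simp add: weight_ge_def)

lemma weight_ge_0 [simp]: "weight_ge \<omega> N 0"
  by (simp add: weight_ge_def)

lemma weight_ge_trivial [simp]: "weight_ge \<omega> 0 A"
  by (simp add: weight_ge_def)

lemma weight_ge_add: "weight_ge \<omega> N A \<Longrightarrow> weight_ge \<omega> N B \<Longrightarrow> weight_ge \<omega> N (A + B)"
  by (simp add: weight_ge_def)

lemma weight_ge_diff: "weight_ge \<omega> N A \<Longrightarrow> weight_ge \<omega> N B \<Longrightarrow> weight_ge \<omega> N (A - B)"
  by (simp add: weight_ge_def)

lemma weight_ge_uminus: "weight_ge \<omega> N A \<Longrightarrow> weight_ge \<omega> N (- A)"
  by (simp add: weight_ge_def)

lemma weight_ge_sum: "(\<And>x. x \<in> S \<Longrightarrow> weight_ge \<omega> N (f x)) \<Longrightarrow> weight_ge \<omega> N (sum f S)"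
  by (induction S rule: infinite_finite_induct) (auto intro: weight_ge_add)

lemma weight_ge_const2_mult: "weight_ge \<omega> N A \<Longrightarrow> weight_ge \<omega> N (const2 c * A)"
  by (simp add: weight_ge_def)

lemma weight_ge_mult:
  assumes "superadditive \<omega>" "weight_ge \<omega> M A" "weight_ge \<omega> N B" "L \<le> M + N"
  shows "weight_ge \<omega> L (A * B)"
  unfolding weight_ge_def
proof (intro allI impI)
  fix m n :: nat
  assume mn: "\<omega> m n < L"
  have "A $ k $ l * B $ (m - k) $ (n - l) = 0" if "k \<le> m" "l \<le> n" for k l
  proof -
    have "\<omega> k l + \<omega> (m - k) (n - l) \<le> \<omega> (k + (m - k)) (l + (n - l))"
      using assms(1) unfolding superadditive_def by blast
    then have "\<omega> k l < M \<or> \<omega> (m - k) (n - l) < N" using that mn assms(4) by auto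
    then show ?thesis using assms(2,3) by (auto simp: weight_ge_def)
  qed
  then show "(A * B) $ m $ n = 0"
    by (auto simp: fps_mult_nth fps_sum_nth intro!: sum.neutral)
qed

lemma weight_ge_mult_right:
  assumes "superadditive \<omega>" "weight_ge \<omega> N A"
  shows "weight_ge \<omega> N (A * B)" "weight_ge \<omega> N (B * A)"
  using weight_ge_mult[OF assms(1,2) weight_ge_trivial, of N B]
    weight_ge_mult[OF assms(1) weight_ge_trivial assms(2), of N B] by auto

lemma weight_ge_power:
  assumes "superadditive \<omega>" "weight_ge \<omega> N A"
  shows "weight_ge \<omega> (k * N) (A ^ k)"
  by (induction k) (auto intro: weight_ge_mult assms)

lemma weight_ge_power_diff:
  assumes "superadditive \<omega>" "weight_ge \<omega> p A" "weight_ge \<omega> p B" "weight_ge \<omega> q (A - B)"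
    and "L \<le> q + (n - 1) * p" "n > 0"
  shows "weight_ge \<omega> L (A ^ n - B ^ n)"
proof -
  have "A ^ n - B ^ n = (A - B) * (\<Sum>i<n. B ^ (n - Suc i) * A ^ i)"
    by (rule power_diff_sumr2)
  moreover have "weight_ge \<omega> ((n - 1) * p) (B ^ (n - Suc i) * A ^ i)" if "i < n" for i
  proof (rule weight_ge_mult[OF assms(1) weight_ge_power weight_ge_power])
    show "(n - 1) * p \<le> (n - Suc i) * p + i * p"
      using that by (simp flip: add_mult_distrib)
  qed (use assms in auto)
  ultimately show ?thesis
    by (auto intro!: weight_ge_mult[OF assms(1,4) weight_ge_sum assms(5)])
qed

lemma weight_ge_power_mult_diff:
  assumes "superadditive \<omega>"
    and "weight_ge \<omega> p P" "weight_ge \<omega> p P'" "weight_ge \<omega> (p + e) (P - P')"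
    and "weight_ge \<omega> q Q" "weight_ge \<omega> q Q'" "weight_ge \<omega> (q + e) (Q - Q')"
  shows "weight_ge \<omega> (p * i + q * j + e) (P ^ i * Q ^ j - P' ^ i * Q' ^ j)"
proof -
  have pow: "weight_ge \<omega> (p * k + e) (A ^ k - B ^ k)"
    if "weight_ge \<omega> p A" "weight_ge \<omega> p B" "weight_ge \<omega> (p + e) (A - B)" for p k A B
  proof (cases k)
    case (Suc l)
    then show ?thesis by (intro weight_ge_power_diff[OF assms(1) that]) (auto simp: algebra_simps)
  qed simp
  have "P ^ i * Q ^ j - P' ^ i * Q' ^ j = (P ^ i - P' ^ i) * Q ^ j + P' ^ i * (Q ^ j - Q' ^ j)"
    by (simp add: algebra_simps)
  moreover have "weight_ge \<omega> (p * i + q * j + e) ((P ^ i - P' ^ i) * Q ^ j)"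
    by (rule weight_ge_mult[OF assms(1) pow[OF assms(2,3,4)] weight_ge_power[OF assms(1,5)]])
      (simp add: algebra_simps)
  moreover have "weight_ge \<omega> (p * i + q * j + e) (P' ^ i * (Q ^ j - Q' ^ j))"
    by (rule weight_ge_mult[OF assms(1) weight_ge_power[OF assms(1,3)] pow[OF assms(5,6,7)]])
      (simp add: algebra_simps)
  ultimately show ?thesis by (simp add: weight_ge_add)
qed

lemma weight_ge_all_imp_0: "(\<And>N. weight_ge \<omega> N A) \<Longrightarrow> A = 0"
  by (rule series2_eqI) (auto simp: weight_ge_def)

definition lin_weight :: "nat \<Rightarrow> nat \<Rightarrow> nat \<Rightarrow> nat \<Rightarrow> nat" where
  "lin_weight p q i j = p * i + q * j"

lemma superadditive_lin_weight [simp]: "superadditive (lin_weight p q)"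
  by (simp add: superadditive_def lin_weight_def algebra_simps)

lemma terms_degree_ge_iff: "terms_degree_ge d A \<longleftrightarrow> weight_ge (lin_weight 1 1) d A"
  by (simp add: terms_degree_ge_def weight_ge_def lin_weight_def)

section \<open>Substitution: estimates, multiplicativity and associativity\<close>

lemma subst2_nth:
  "subst2 A P Q $ m $ n = (\<Sum>i\<le>m + n. \<Sum>j\<le>m + n. A $ i $ j * (P ^ i * Q ^ j) $ m $ n)"
  by (simp add: subst2_def)

lemma subst2_add: "subst2 (A + B) P Q = subst2 A P Q + subst2 B P Q"
  by (rule series2_eqI) (simp add: subst2_nth algebra_simps sum.distrib)

lemma subst2_diff: "subst2 (A - B) P Q = subst2 A P Q - subst2 B P Q"
  by (rule series2_eqI) (simp add: subst2_nth algebra_simps sum_subtractf)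

lemma subst2_0 [simp]: "subst2 0 P Q = 0"
  by (rule series2_eqI) (simp add: subst2_nth)

lemma subst2_sum: "subst2 (sum f S) P Q = (\<Sum>x\<in>S. subst2 (f x) P Q)"
  by (induction S rule: infinite_finite_induct) (auto simp: subst2_add)

lemma subst2_weight:
  assumes "superadditive \<omega>" "weight_ge \<omega> p P" "weight_ge \<omega> q Q" "weight_ge (lin_weight p q) N A"
  shows "weight_ge \<omega> N (subst2 A P Q)"
  unfolding weight_ge_def
proof (intro allI impI)
  fix m n assume mn: "\<omega> m n < N"
  have "A $ i $ j * (P ^ i * Q ^ j) $ m $ n = 0" for i j
  proof (cases "p * i + q * j < N")
    case True
    then show ?thesis using assms(4) by (simp add: weight_ge_def lin_weight_def)
  next
    case False
    have "weight_ge \<omega> (p * i + q * j) (P ^ i * Q ^ j)"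
      by (rule weight_ge_mult[OF assms(1) weight_ge_power weight_ge_power])
        (use assms in \<open>auto simp: mult.commute\<close>)
    then show ?thesis using False mn by (simp add: weight_ge_def)
  qed
  then show "subst2 A P Q $ m $ n = 0" unfolding subst2_nth by (intro sum.neutral ballI)
qed

text \<open>Changing \<open>P\<close> and \<open>Q\<close> by \<open>e\<close> orders beyond their
  own weights changes each \<open>P ^ i * Q ^ j\<close> by \<open>e\<close> orders beyond
  \<open>p * i + q * j\<close>. This controls the replacement of a surface by the model and of a map
  by its leading part.\<close>

lemma subst2_weight_diff:
  assumes "superadditive \<omega>"
    and "weight_ge \<omega> p P" "weight_ge \<omega> p P'" "weight_ge \<omega> (p + e) (P - P')"
    and "weight_ge \<omega> q Q" "weight_ge \<omega> q Q'" "weight_ge \<omega> (q + e) (Q - Q')"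
    and "weight_ge (lin_weight p q) N A"
  shows "weight_ge \<omega> (N + e) (subst2 A P Q - subst2 A P' Q')"
  unfolding weight_ge_def
proof (intro allI impI)
  fix m n assume mn: "\<omega> m n < N + e"
  have "A $ i $ j * (P ^ i * Q ^ j) $ m $ n - A $ i $ j * (P' ^ i * Q' ^ j) $ m $ n = 0" for i j
  proof (cases "p * i + q * j < N")
    case True
    then show ?thesis using assms(8) by (simp add: weight_ge_def lin_weight_def)
  next
    case False
    then have "(P ^ i * Q ^ j - P' ^ i * Q' ^ j) $ m $ n = 0"
      using mn by (intro weight_geD[OF weight_ge_power_mult_diff[OF assms(1-7)]]) auto
    then show ?thesis by simp
  qed
  then show "(subst2 A P Q - subst2 A P' Q') $ m $ n = 0"
    unfolding fps_sub_nth subst2_nth sum_subtractf[symmetric] by (intro sum.neutral ballI)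
qed

lemma subst2_nth_ge:
  assumes "P $ 0 $ 0 = 0" "Q $ 0 $ 0 = 0" "m + n \<le> N"
  shows "subst2 A P Q $ m $ n = (\<Sum>i\<le>N. \<Sum>j\<le>N. A $ i $ j * (P ^ i * Q ^ j) $ m $ n)"
proof -
  have "(\<Sum>j\<le>N. A $ i $ j * (P ^ i * Q ^ j) $ m $ n) =
      (\<Sum>j\<le>m + n. A $ i $ j * (P ^ i * Q ^ j) $ m $ n)" for i
    by (rule sum.mono_neutral_right) (use assms subst2_cutoff[OF assms(1,2)] in auto)
  moreover have "(\<Sum>i\<le>N. \<Sum>j\<le>m + n. A $ i $ j * (P ^ i * Q ^ j) $ m $ n) =
      (\<Sum>i\<le>m + n. \<Sum>j\<le>m + n. A $ i $ j * (P ^ i * Q ^ j) $ m $ n)"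
    by (rule sum.mono_neutral_right)
      (use assms subst2_cutoff[OF assms(1,2)] in \<open>auto intro!: sum.neutral\<close>)
  ultimately show ?thesis by (simp add: subst2_nth)
qed

lemma weight_ge_1_iff: "weight_ge (lin_weight 1 1) 1 P \<longleftrightarrow> P $ 0 $ 0 = 0"
  by (auto simp: weight_ge_def lin_weight_def)

lemma subst2_degree:
  assumes "P $ 0 $ 0 = 0" "Q $ 0 $ 0 = 0" "weight_ge (lin_weight 1 1) N A"
  shows "weight_ge (lin_weight 1 1) N (subst2 A P Q)"
  by (rule subst2_weight[of _ 1 _ 1]) (use assms weight_ge_1_iff in auto)

lemma subst2_monomial:
  assumes "P $ 0 $ 0 = 0" "Q $ 0 $ 0 = 0"
  shows "subst2 (const2 c * var1 ^ k * var2 ^ l) P Q = const2 c * P ^ k * Q ^ l"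
proof (rule series2_eqI)
  fix m n
  have "subst2 (const2 c * var1 ^ k * var2 ^ l) P Q $ m $ n =
      (\<Sum>i\<le>m + n. if i = k then \<Sum>j\<le>m + n. if j = l then c * (P ^ k * Q ^ l) $ m $ n else 0 else 0)"
    unfolding subst2_nth monomial_nth by (rule sum.cong) (auto intro!: sum.cong simp del: sum.delta)
  also have "\<dots> = (if k \<le> m + n \<and> l \<le> m + n then c * (P ^ k * Q ^ l) $ m $ n else 0)"
    by simp
  also have "\<dots> = c * (P ^ k * Q ^ l) $ m $ n"
    using subst2_cutoff[OF assms, of m n k l] by auto
  finally show "subst2 (const2 c * var1 ^ k * var2 ^ l) P Q $ m $ n =
      (const2 c * P ^ k * Q ^ l) $ m $ n"
    by (simp add: mult.assoc)
qed

text \<open>Identities for substitution are checked on monomials and extended by linearity to finite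
  sums. The square cut-off keeps all terms of degree below \<open>N\<close>, so each identity then
  holds modulo every degree.\<close>

definition truncation :: "nat \<Rightarrow> series2 \<Rightarrow> series2" where
  "truncation N A = (\<Sum>i<N. \<Sum>j<N. const2 (A $ i $ j) * var1 ^ i * var2 ^ j)"

lemma truncation_nth: "truncation N A $ i $ j = (if i < N \<and> j < N then A $ i $ j else 0)"
proof -
  have "truncation N A $ i $ j =
      (\<Sum>k<N. if k = i then \<Sum>l<N. if l = j then A $ i $ j else 0 else 0)"
    unfolding truncation_def fps_sum_nth monomial_nth
    by (intro sum.cong refl) (auto intro!: sum.cong)
  then show ?thesis by simp
qed

lemma truncation_weight: "weight_ge (lin_weight 1 1) N (A - truncation N A)"
  by (auto simp: weight_ge_def truncation_nth lin_weight_def)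

lemma subst2_truncation_weight:
  assumes "P $ 0 $ 0 = 0" "Q $ 0 $ 0 = 0"
  shows "weight_ge (lin_weight 1 1) N (subst2 A P Q - subst2 (truncation N A) P Q)"
  using subst2_degree[OF assms truncation_weight, of N A] by (simp add: subst2_diff)

lemma subst2_mult:
  assumes "P $ 0 $ 0 = 0" "Q $ 0 $ 0 = 0"
  shows "subst2 (A * B) P Q = subst2 A P Q * subst2 B P Q"
proof -
  let ?d = "lin_weight 1 1"
  have "weight_ge ?d N (subst2 (A * B) P Q - subst2 A P Q * subst2 B P Q)" for N
  proof -
    let ?A = "truncation N A" and ?B = "truncation N B"
    have "subst2 (?A * ?B) P Q = subst2 ?A P Q * subst2 ?B P Q"
    proof -
      have mon: "subst2 ((const2 c * var1 ^ i * var2 ^ j) * (const2 d * var1 ^ k * var2 ^ l)) P Q =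
          (const2 c * P ^ i * Q ^ j) * (const2 d * P ^ k * Q ^ l)" for c d i j k l
        using subst2_monomial[OF assms, of "c * d" "i + k" "j + l"]
        by (simp add: power_add ac_simps)
      show ?thesis
        unfolding truncation_def sum_distrib_left sum_distrib_right subst2_sum mon
          subst2_monomial[OF assms] by simp
    qed
    moreover have "A * B - ?A * ?B = (A - ?A) * B + ?A * (B - ?B)"
      by (simp add: algebra_simps)
    then have "weight_ge ?d N (A * B - ?A * ?B)"
      by (metis superadditive_lin_weight truncation_weight weight_ge_add weight_ge_mult_right)
    then have "weight_ge ?d N (subst2 (A * B) P Q - subst2 (?A * ?B) P Q)"
      using subst2_degree[OF assms] by (metis subst2_diff)
    moreover have "subst2 A P Q * subst2 B P Q - subst2 ?A P Q * subst2 ?B P Q =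
        (subst2 A P Q - subst2 ?A P Q) * subst2 B P Q
        + subst2 ?A P Q * (subst2 B P Q - subst2 ?B P Q)"
      by (simp add: algebra_simps)
    then have "weight_ge ?d N (subst2 A P Q * subst2 B P Q - subst2 ?A P Q * subst2 ?B P Q)"
      by (metis superadditive_lin_weight subst2_truncation_weight[OF assms] weight_ge_add
          weight_ge_mult_right)
    ultimately show ?thesis
      using weight_ge_diff[of ?d N "subst2 (A * B) P Q - subst2 (?A * ?B) P Q"] by fastforce
  qed
  then show ?thesis using weight_ge_all_imp_0 by fastforce
qed

lemma subst2_const2 [simp]: "P $ 0 $ 0 = 0 \<Longrightarrow> Q $ 0 $ 0 = 0 \<Longrightarrow> subst2 (const2 c) P Q = const2 c"
  using subst2_monomial[of P Q c 0 0] by simp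

lemma subst2_1 [simp]: "P $ 0 $ 0 = 0 \<Longrightarrow> Q $ 0 $ 0 = 0 \<Longrightarrow> subst2 1 P Q = 1"
  using subst2_const2[of P Q 1] by simp

lemma subst2_var1 [simp]: "P $ 0 $ 0 = 0 \<Longrightarrow> Q $ 0 $ 0 = 0 \<Longrightarrow> subst2 var1 P Q = P"
  using subst2_monomial[of P Q 1 1 0] by simp

lemma subst2_var2 [simp]: "P $ 0 $ 0 = 0 \<Longrightarrow> Q $ 0 $ 0 = 0 \<Longrightarrow> subst2 var2 P Q = Q"
  using subst2_monomial[of P Q 1 0 1] by simp

lemma subst2_power:
  "P $ 0 $ 0 = 0 \<Longrightarrow> Q $ 0 $ 0 = 0 \<Longrightarrow> subst2 (A ^ n) P Q = subst2 A P Q ^ n"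
  by (induction n) (simp_all add: subst2_mult)

lemma subst2_nth_00 [simp]: "subst2 A P Q $ 0 $ 0 = A $ 0 $ 0"
  by (simp add: subst2_nth)

lemma subst2_assoc:
  assumes "P $ 0 $ 0 = 0" "Q $ 0 $ 0 = 0" "U $ 0 $ 0 = 0" "V $ 0 $ 0 = 0"
  shows "subst2 (subst2 A P Q) U V = subst2 A (subst2 P U V) (subst2 Q U V)"
proof -
  let ?d = "lin_weight 1 1"
  have "weight_ge ?d N (subst2 (subst2 A P Q) U V - subst2 A (subst2 P U V) (subst2 Q U V))" for N
  proof -
    let ?A = "truncation N A"
    have "subst2 (subst2 ?A P Q) U V = subst2 ?A (subst2 P U V) (subst2 Q U V)"
      using assms unfolding truncation_def
      by (simp add: subst2_sum subst2_monomial subst2_mult subst2_power)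
    moreover have "weight_ge ?d N (subst2 (subst2 A P Q) U V - subst2 (subst2 ?A P Q) U V)"
      using subst2_degree[OF assms(3,4)  subst2_truncation_weight[OF assms(1,2)], of N A]
      by (simp add: subst2_diff)
    moreover have "weight_ge ?d N (subst2 A (subst2 P U V) (subst2 Q U V)
        - subst2 ?A (subst2 P U V) (subst2 Q U V))"
      by (rule subst2_truncation_weight) (use assms in auto)
    ultimately show ?thesis
      using weight_ge_diff[of ?d N "subst2 (subst2 A P Q) U V - subst2 (subst2 ?A P Q) U V"]
      by fastforce
  qed
  then show ?thesis using weight_ge_all_imp_0 by fastforce
qed

section \<open>Lowest-degree terms, and bijectivity of substitution\<close>

lemma power_mult_leading_nth:
  assumes P: "weight_ge (lin_weight 1 1) 2 (P - const2 \<alpha> * var1)"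
    and Q: "weight_ge (lin_weight 1 1) 2 (Q - const2 \<beta> * var2)"
    and mn: "m + n = i + j"
  shows "(P ^ i * Q ^ j) $ m $ n = (if m = i \<and> n = j then \<alpha> ^ i * \<beta> ^ j else 0)"
proof -
  let ?d = "lin_weight 1 1"
  define P0 where "P0 = const2 \<alpha> * var1"
  define Q0 where "Q0 = const2 \<beta> * var2"
  have deg1: "weight_ge ?d 1 P0" "weight_ge ?d 1 Q0"
    by (auto simp: weight_ge_def P0_def Q0_def var1_nth var2_nth lin_weight_def)
  have PQ: "weight_ge ?d 2 (P - P0)" "weight_ge ?d 2 (Q - Q0)"
    using P Q by (simp_all add: P0_def Q0_def)
  have deg1': "weight_ge ?d 1 P" "weight_ge ?d 1 Q"
    using weight_ge_add[OF deg1(1) weight_ge_mono[OF PQ(1)]]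
      weight_ge_add[OF deg1(2) weight_ge_mono[OF PQ(2)]] by simp_all
  have "weight_ge ?d (i + j + 1) (P ^ i * Q ^ j - P0 ^ i * Q0 ^ j)"
    using weight_ge_power_mult_diff[of ?d 1 P P0 1 1 Q Q0 i j] deg1 deg1' PQ
    by (simp add: numeral_2_eq_2)
  moreover have "P0 ^ i * Q0 ^ j = const2 (\<alpha> ^ i * \<beta> ^ j) * var1 ^ i * var2 ^ j"
    by (simp add: P0_def Q0_def power_mult_distrib ac_simps)
  ultimately have "(P ^ i * Q ^ j) $ m $ n = (const2 (\<alpha> ^ i * \<beta> ^ j) * var1 ^ i * var2 ^ j) $ m $ n"
    using mn by (auto simp: weight_ge_def lin_weight_def)
  then show ?thesis unfolding monomial_nth .
qed

text \<open>The linear part of \<open>(P, Q)\<close> is diagonal, so in the lowest degree of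
  \<open>A\<close> substitution only rescales the monomials.\<close>

lemma subst2_leading_nth:
  assumes P: "weight_ge (lin_weight 1 1) 2 (P - const2 \<alpha> * var1)"
    and Q: "weight_ge (lin_weight 1 1) 2 (Q - const2 \<beta> * var2)"
    and A: "weight_ge (lin_weight 1 1) (m + n) A"
  shows "subst2 A P Q $ m $ n = A $ m $ n * \<alpha> ^ m * \<beta> ^ n"
proof -
  have 0: "P $ 0 $ 0 = 0" "Q $ 0 $ 0 = 0"
    using weight_geD[OF P, of 0 0] weight_geD[OF Q, of 0 0]
    by (simp_all add: lin_weight_def var1_nth var2_nth del: fps_mult_nth_0)
  have "A $ i $ j * (P ^ i * Q ^ j) $ m $ n =
      (if i = m then if j = n then A $ m $ n * \<alpha> ^ m * \<beta> ^ n else 0 else 0)" for i j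
  proof (cases "i + j" "m + n" rule: linorder_cases)
    case less
    then show ?thesis using weight_geD[OF A, of i j] by (auto simp: lin_weight_def)
  next
    case equal
    then show ?thesis using power_mult_leading_nth[OF P Q, of m n i j] by auto
  next
    case greater
    then show ?thesis using subst2_cutoff[OF 0 greater] by auto
  qed
  then have "subst2 A P Q $ m $ n = (\<Sum>i\<le>m + n. \<Sum>j\<le>m + n.
      (if i = m then if j = n then A $ m $ n * \<alpha> ^ m * \<beta> ^ n else 0 else 0))"
    unfolding subst2_nth by (intro sum.cong refl) blast
  also have "\<dots> = (\<Sum>i\<le>m + n. if i = m then A $ m $ n * \<alpha> ^ m * \<beta> ^ n else 0)"
    by (intro sum.cong refl) auto
  finally show ?thesis by simp
qed

text \<open>The rescaling factors are nonzero, so the coefficients of \<open>A\<close> vanish degree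
  by degree.\<close>

lemma subst2_eq_0_imp_0:
  assumes P: "weight_ge (lin_weight 1 1) 2 (P - const2 \<alpha> * var1)"
    and Q: "weight_ge (lin_weight 1 1) 2 (Q - const2 \<beta> * var2)"
    and nz: "\<alpha> \<noteq> 0" "\<beta> \<noteq> 0"
    and A: "subst2 A P Q = 0"
  shows "A = 0"
proof (rule weight_ge_all_imp_0)
  fix N show "weight_ge (lin_weight 1 1) N A"
  proof (induction N)
    case (Suc N)
    then have "A $ m $ n = 0" if "m + n = N" for m n
      using subst2_leading_nth[OF P Q, of m n A] that nz A by simp
    with Suc show ?case by (auto simp: weight_ge_def lin_weight_def less_Suc_eq)
  qed simp
qed

lemma stabilizing_limit:
  assumes "\<And>n i. w i < (n :: nat) \<Longrightarrow> x (Suc n) i = x n i"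
  obtains y where "\<And>n i. w i < n \<Longrightarrow> y i = x n i"
proof -
  have "x n i = x (Suc (w i)) i" if "w i < n" for n i
    using that by (induction n) (auto simp: less_Suc_eq assms)
  then show ?thesis by (intro that[of "\<lambda>i. x (Suc (w i)) i"]) metis
qed

text \<open>Completeness: a coefficient of weight \<open>n\<close> no longer changes after stage
  \<open>n + 1\<close>. Applied to the components of a transformation, each in its own
  weight.\<close>

lemma weight_ge_limit:
  assumes "\<And>n. weight_ge \<omega> n (X (Suc n) - X n)"
  obtains Y where "\<And>n. weight_ge \<omega> n (Y - X n)"
proof -
  have stable: "X (Suc n) $ fst ij $ snd ij = X n $ fst ij $ snd ij"
    if "\<omega> (fst ij) (snd ij) < n" for n ij
    using weight_geD[OF assms that] by simp
  obtain y where y: "\<And>n ij. \<omega> (fst ij) (snd ij) < n \<Longrightarrow> y ij = X n $ fst ij $ snd ij"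
    using stabilizing_limit[of "\<lambda>ij. \<omega> (fst ij) (snd ij)" "\<lambda>n ij. X n $ fst ij $ snd ij", OF stable]
    by blast
  show ?thesis
    by (rule that[of "Abs_fps (\<lambda>i. Abs_fps (\<lambda>j. y (i, j)))"]) (simp add: weight_ge_def y)
qed

text \<open>Successive approximation: the substitution is the identity modulo higher degree, so
  adding the current error to the approximation raises the order of the error by one.\<close>

lemma subst2_surjective:
  assumes P: "weight_ge (lin_weight 1 1) 2 (P - var1)"
    and Q: "weight_ge (lin_weight 1 1) 2 (Q - var2)"
  obtains A where "subst2 A P Q = B"
proof -
  let ?d = "lin_weight 1 1"
  have 0: "P $ 0 $ 0 = 0" "Q $ 0 $ 0 = 0"
    using weight_geD[OF P, of 0 0] weight_geD[OF Q, of 0 0]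
    by (simp_all add: lin_weight_def var1_nth var2_nth)
  define X where "X = rec_nat 0 (\<lambda>_ A. A + (B - subst2 A P Q))"
  have XSuc: "X (Suc n) = X n + (B - subst2 (X n) P Q)" for n by (simp add: X_def)
  have X: "weight_ge ?d n (B - subst2 (X n) P Q)" for n
  proof (induction n)
    case (Suc n)
    define E where "E = B - subst2 (X n) P Q"
    have E: "weight_ge ?d n E" using Suc by (simp add: E_def)
    have "weight_ge ?d (Suc n) (E - subst2 E P Q)"
      unfolding weight_ge_def
    proof (intro allI impI)
      fix i j assume ij: "?d i j < Suc n"
      then have "weight_ge ?d (i + j) E"
        using weight_ge_mono[OF E] by (simp add: lin_weight_def)
      then show "(E - subst2 E P Q) $ i $ j = 0"
        using subst2_leading_nth[of P 1 Q 1 i j E] P Q by simp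
    qed
    moreover have "E - subst2 E P Q = B - subst2 (X (Suc n)) P Q"
      by (simp only: XSuc subst2_add E_def) simp
    ultimately show ?case by simp
  qed simp
  have increment: "weight_ge ?d n (X (Suc n) - X n)" for n
    using X by (simp add: XSuc)
  obtain A where A: "\<And>n. weight_ge ?d n (A - X n)"
    using weight_ge_limit[OF increment] by blast
  have "weight_ge ?d n (B - subst2 A P Q)" for n
    using weight_ge_diff[OF X subst2_degree[OF 0 A]] by (simp add: subst2_diff)
  then have "B - subst2 A P Q = 0" by (rule weight_ge_all_imp_0)
  then show ?thesis by (intro that) simp
qed

section \<open>Conjugation\<close>

lemma conj2_nth [simp]: "conj2 A $ i $ j = cnj (A $ j $ i)"
  by (simp add: conj2_def)

lemma conj2_conj2 [simp]: "conj2 (conj2 A) = A"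
  by (rule series2_eqI) simp

lemma conj2_add: "conj2 (A + B) = conj2 A + conj2 B"
  by (rule series2_eqI) simp

lemma conj2_diff: "conj2 (A - B) = conj2 A - conj2 B"
  by (rule series2_eqI) simp

lemma conj2_mult: "conj2 (A * B) = conj2 A * conj2 B"
proof (rule series2_eqI)
  fix i j
  show "conj2 (A * B) $ i $ j = (conj2 A * conj2 B) $ i $ j"
    by (simp add: fps_mult_nth fps_sum_nth) (rule sum.swap)
qed

lemma conj2_const2 [simp]: "conj2 (const2 c) = const2 (cnj c)"
  by (rule series2_eqI) (simp add: const2_nth)

lemma conj2_0 [simp]: "conj2 0 = 0"
  by (rule series2_eqI) simp

lemma conj2_1 [simp]: "conj2 1 = 1"
  using conj2_const2[of 1] by simp

lemma conj2_power: "conj2 (A ^ n) = conj2 A ^ n"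
  by (induction n) (simp_all add: conj2_mult)

lemma conj2_var [simp]: "conj2 var1 = var2" "conj2 var2 = var1"
  by (auto intro!: series2_eqI simp: var1_nth var2_nth)

lemma conj2_subst2: "conj2 (subst2 A P Q) = subst2 (conj2 A) (conj2 Q) (conj2 P)"
proof (rule series2_eqI)
  fix m n
  have "conj2 (subst2 A P Q) $ m $ n =
     (\<Sum>i\<le>m + n. \<Sum>j\<le>m + n. cnj (A $ i $ j) * conj2 (P ^ i * Q ^ j) $ m $ n)"
    by (simp add: subst2_nth add.commute)
  also have "\<dots> = (\<Sum>i\<le>m + n. \<Sum>j\<le>m + n. cnj (A $ j $ i) * conj2 (P ^ j * Q ^ i) $ m $ n)"
    by (rule sum.swap)
  also have "\<dots> = subst2 (conj2 A) (conj2 Q) (conj2 P) $ m $ n"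
    by (simp add: subst2_nth conj2_mult conj2_power mult.commute)
  finally show "conj2 (subst2 A P Q) $ m $ n = subst2 (conj2 A) (conj2 Q) (conj2 P) $ m $ n" .
qed

lemma weight_ge_conj2: "(\<And>i j. \<omega> i j = \<omega> j i) \<Longrightarrow> weight_ge \<omega> N A \<Longrightarrow> weight_ge \<omega> N (conj2 A)"
  by (metis complex_cnj_zero conj2_nth weight_ge_def)

section \<open>Formal transformations\<close>

lemma weight_ge_2_iff:
  "weight_ge (lin_weight 1 1) 2 A \<longleftrightarrow> A $ 0 $ 0 = 0 \<and> A $ 1 $ 0 = 0 \<and> A $ 0 $ 1 = 0"
  by (auto simp: weight_ge_def lin_weight_def less_2_cases_iff add_is_1)

lemma subst2_nth_1:
  assumes "P $ 0 $ 0 = 0" "Q $ 0 $ 0 = 0"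
  shows "subst2 A P Q $ 1 $ 0 = A $ 1 $ 0 * P $ 1 $ 0 + A $ 0 $ 1 * Q $ 1 $ 0"
    and "subst2 A P Q $ 0 $ 1 = A $ 1 $ 0 * P $ 0 $ 1 + A $ 0 $ 1 * Q $ 0 $ 1"
  using assms by (simp_all add: subst2_nth fps_mult_nth fps_sum_nth)

text \<open>Kept apart from the condition on the Jacobian because left division yields a factor
  whose invertibility is deduced only afterwards.\<close>

definition preserves_origin :: "formal_map \<Rightarrow> bool" where
  "preserves_origin F \<longleftrightarrow> fst F $ 0 $ 0 = 0 \<and> snd F $ 0 $ 0 = 0"

definition jacobian :: "formal_map \<Rightarrow> complex" where
  "jacobian F = fst F $ 1 $ 0 * snd F $ 0 $ 1 - fst F $ 0 $ 1 * snd F $ 1 $ 0"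

lemma formal_transformation_iff:
  "formal_transformation F \<longleftrightarrow> preserves_origin F \<and> jacobian F \<noteq> 0"
  by (simp add: formal_transformation_def preserves_origin_def jacobian_def)

lemma preserves_origin_map_compose:
  "preserves_origin G \<Longrightarrow> preserves_origin (map_compose G F)"
  by (simp add: preserves_origin_def map_compose_def)

lemma jacobian_map_compose:
  assumes "preserves_origin F"
  shows "jacobian (map_compose G F) = jacobian G * jacobian F"
  using assms
  by (simp only: preserves_origin_def jacobian_def map_compose_def fst_conv snd_conv subst2_nth_1)
    (simp add: algebra_simps)

lemma formal_transformation_map_compose_iff:
  assumes "preserves_origin G" "formal_transformation F"
  shows "formal_transformation (map_compose G F) \<longleftrightarrow> formal_transformation G"
  using assms jacobian_map_compose[of F G] preserves_origin_map_compose[of G F]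
  by (auto simp: formal_transformation_iff)

lemma map_compose_assoc:
  assumes "preserves_origin G" "preserves_origin F"
  shows "map_compose (map_compose K G) F = map_compose K (map_compose G F)"
  using assms by (simp add: map_compose_def preserves_origin_def subst2_assoc)

text \<open>Writes every candidate normalization as some \<open>S\<close> after a fixed
  \<open>F\<close>. Undoing the linear part of \<open>F\<close> first makes
  \<open>subst2_surjective\<close> applicable.\<close>

lemma left_division:
  assumes F: "formal_transformation F" and G: "preserves_origin G"
  obtains S where "preserves_origin S" "map_compose S F = G"
proof -
  define D where "D = jacobian F"
  have D: "D \<noteq> 0" and F0: "fst F $ 0 $ 0 = 0" "snd F $ 0 $ 0 = 0"
    using F by (auto simp: formal_transformation_iff D_def preserves_origin_def)
  \<comment> \<open>\<open>U\<close> and \<open>V\<close> are the rows of the inverse of the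
    Jacobian matrix of \<open>F\<close>.\<close>
  define U where "U = const2 (snd F $ 0 $ 1 / D) * var1 - const2 (fst F $ 0 $ 1 / D) * var2"
  define V where "V = const2 (fst F $ 1 $ 0 / D) * var2 - const2 (snd F $ 1 $ 0 / D) * var1"
  have UV0: "U $ 0 $ 0 = 0" "V $ 0 $ 0 = 0"
    by (simp_all add: U_def V_def var1_nth var2_nth del: fps_mult_nth_0)
  define P where "P = subst2 U (fst F) (snd F)"
  define Q where "Q = subst2 V (fst F) (snd F)"
  have PQ: "P = const2 (snd F $ 0 $ 1 / D) * fst F - const2 (fst F $ 0 $ 1 / D) * snd F"
     "Q = const2 (fst F $ 1 $ 0 / D) * snd F - const2 (snd F $ 1 $ 0 / D) * fst F"
    using F0 by (simp_all add: P_def Q_def U_def V_def subst2_diff subst2_mult)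
  have "weight_ge (lin_weight 1 1) 2 (P - var1)" "weight_ge (lin_weight 1 1) 2 (Q - var2)"
    unfolding weight_ge_2_iff PQ fps_sub_nth const2_mult_nth var1_nth var2_nth F0
    using D by (auto simp: field_simps) (simp_all add: D_def jacobian_def algebra_simps)
  then have "\<exists>A. subst2 (subst2 A U V) (fst F) (snd F) = B" for B
    using subst2_assoc[OF UV0 F0] subst2_surjective[of P Q B] unfolding P_def Q_def by metis
  then obtain A B where AB: "subst2 A (fst F) (snd F) = fst G" "subst2 B (fst F) (snd F) = snd G"
    by metis
  show ?thesis
  proof (rule that[of "(A, B)"])
    show "map_compose (A, B) F = G" using AB by (simp add: map_compose_def)
    have "A $ 0 $ 0 = fst G $ 0 $ 0" "B $ 0 $ 0 = snd G $ 0 $ 0"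
      by (simp_all flip: AB)
    then show "preserves_origin (A, B)" using G by (simp add: preserves_origin_def)
  qed
qed

text \<open>
  The cancellation direction holds because substituting the first component of \<open>T\<close>, restricted to the
  source surface, and its conjugate is injective on series.
\<close>

lemma maps_graph_map_compose_iff:
  assumes T: "formal_transformation T" and S: "preserves_origin S"
    and H: "weight_ge (lin_weight 1 1) 2 H" and K: "weight_ge (lin_weight 1 1) 2 K"
    and J: "J $ 0 $ 0 = 0"
    and TH: "maps_graph T H K"
  shows "maps_graph (map_compose S T) H J \<longleftrightarrow> maps_graph S K J"
proof -
  define P where "P = subst2 (fst T) var1 H"
  have 0: "fst T $ 0 $ 0 = 0" "snd T $ 0 $ 0 = 0" "fst S $ 0 $ 0 = 0" "snd S $ 0 $ 0 = 0"
    "H $ 0 $ 0 = 0" "K $ 0 $ 0 = 0" "var1 $ 0 $ 0 = 0" "P $ 0 $ 0 = 0" "conj2 P $ 0 $ 0 = 0"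
    using T S H[unfolded weight_ge_2_iff] K[unfolded weight_ge_2_iff]
    by (auto simp: formal_transformation_iff preserves_origin_def var1_nth P_def)
  have T2: "subst2 (snd T) var1 H = subst2 K P (conj2 P)"
    using TH by (simp add: maps_graph_def P_def)
  have P1: "P $ 1 $ 0 = fst T $ 1 $ 0" "P $ 0 $ 1 = 0"
    using H[unfolded weight_ge_2_iff] subst2_nth_1[OF 0(7,5), of "fst T"]
    by (simp_all add: var1_nth P_def)
  \<comment> \<open>Neither surface has linear terms, so the second component has no term in
    \<open>z\<close>; the nonzero Jacobian then forces a nonzero coefficient of \<open>z\<close> in
    the first.\<close>
  have "snd T $ 1 $ 0 = subst2 (snd T) var1 H $ 1 $ 0"
    using H[unfolded weight_ge_2_iff] subst2_nth_1[OF 0(7,5), of "snd T"]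
    by (simp add: var1_nth)
  also have "\<dots> = 0"
    unfolding T2 using subst2_degree[OF 0(8,9) K, unfolded weight_ge_2_iff] by simp
  finally have \<alpha>: "fst T $ 1 $ 0 \<noteq> 0"
    using T by (auto simp: formal_transformation_def)
  have inj: "A = 0" if "subst2 A P (conj2 P) = 0" for A
    by (rule subst2_eq_0_imp_0[OF _ _ _ _ that, of "fst T $ 1 $ 0" "cnj (fst T $ 1 $ 0)"])
      (unfold weight_ge_2_iff fps_sub_nth const2_mult_nth,
        use \<alpha> P1 0 in \<open>simp_all add: var1_nth var2_nth\<close>)
  define R where "R = subst2 (fst S) var1 K"
  have comp: "subst2 (subst2 A (fst T) (snd T)) var1 H = subst2 (subst2 A var1 K) P (conj2 P)" for A
    using 0 by (simp add: subst2_assoc T2 flip: P_def)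
  have cR: "conj2 (subst2 R P (conj2 P)) = subst2 (conj2 R) P (conj2 P)"
    by (simp add: conj2_subst2)
  have R0: "R $ 0 $ 0 = 0" using 0 by (simp add: R_def)
  have "maps_graph (map_compose S T) H J \<longleftrightarrow>
    subst2 (subst2 (snd S) var1 K) P (conj2 P) =
    subst2 J (subst2 R P (conj2 P)) (conj2 (subst2 R P (conj2 P)))"
    by (simp add: maps_graph_def map_compose_def comp R_def)
  also have "\<dots> \<longleftrightarrow> subst2 (subst2 (snd S) var1 K - subst2 J R (conj2 R)) P (conj2 P) = 0"
    using 0 R0 unfolding cR by (simp add: subst2_diff subst2_assoc)
  also have "\<dots> \<longleftrightarrow> maps_graph S K J"
    using inj[of "subst2 (snd S) var1 K - subst2 J R (conj2 R)"]
    by (auto simp: maps_graph_def R_def)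
  finally show ?thesis .
qed

section \<open>The weight of a surface with Moser invariant s\<close>

text \<open>
  A monomial \<open>z\<^sup>i \<zeta>\<^sup>j\<close> is a power of \<open>z\<close> or of \<open>\<zeta>\<close> times \<open>(z \<zeta>)\<close> to the power \<open>min i j\<close>, and \<open>z \<zeta>\<close>
  has weight \<open>s\<close>.
\<close>

definition surface_weight :: "nat \<Rightarrow> nat \<Rightarrow> nat \<Rightarrow> nat" where
  "surface_weight s i j = i + j + (s - 2) * min i j"

definition model :: "nat \<Rightarrow> series2" where
  "model s = var1 * var2 + var1 ^ s + var2 ^ s"

lemma superadditive_surface_weight [simp]: "superadditive (surface_weight s)"
  unfolding superadditive_def surface_weight_def
proof (intro allI)
  fix i j k l :: nat
  have "(s - 2) * min i j + (s - 2) * min k l \<le> (s - 2) * min (i + k) (j + l)"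
    unfolding distrib_left[symmetric] by (rule mult_le_mono2) auto
  then show "i + j + (s - 2) * min i j + (k + l + (s - 2) * min k l)
      \<le> i + k + (j + l) + (s - 2) * min (i + k) (j + l)" by simp
qed

lemma weight_ge_monomial: "N \<le> \<omega> i j \<Longrightarrow> weight_ge \<omega> N (var1 ^ i * var2 ^ j)"
  using monomial_nth[of 1 i j] by (auto simp: weight_ge_def)

lemma weight_ge_var1_power: "N \<le> \<omega> i 0 \<Longrightarrow> weight_ge \<omega> N (var1 ^ i)"
  using weight_ge_monomial[of N \<omega> i 0] by simp

lemma weight_ge_var2_power: "N \<le> \<omega> 0 j \<Longrightarrow> weight_ge \<omega> N (var2 ^ j)"
  using weight_ge_monomial[of N \<omega> 0 j] by simp

lemma weight_ge_var: "N \<le> \<omega> 1 0 \<Longrightarrow> weight_ge \<omega> N var1" "N \<le> \<omega> 0 1 \<Longrightarrow> weight_ge \<omega> N var2"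
  using weight_ge_var1_power[of N \<omega> 1] weight_ge_var2_power[of N \<omega> 1] by simp_all

lemma weight_ge_conj2_surface_weight:
  "weight_ge (surface_weight s) N A \<Longrightarrow> weight_ge (surface_weight s) N (conj2 A)"
  by (rule weight_ge_conj2) (simp_all add: surface_weight_def min.commute)

lemma conj2_model [simp]: "conj2 (model s) = model s"
  by (simp add: model_def conj2_add conj2_mult conj2_power ac_simps)

text \<open>Conjugation of a series in \<open>w\<close> alone, as it acts on the model:
  \<open>model s\<close> is fixed by \<open>conj2\<close>, so only the coefficients change; see
  \<open>conj2_\<sigma>_cnj_second\<close>.\<close>

definition cnj_second :: "complex fps \<Rightarrow> series2" where
  "cnj_second h = fps_const (Abs_fps (\<lambda>j. cnj (h $ j)))"

lemma cnj_second_nth: "cnj_second h $ i $ j = (if i = 0 then cnj (h $ j) else 0)"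
  by (simp add: cnj_second_def)

lemma subst2_fps_const_nth: "subst2 (fps_const h) P Q $ m $ n = (\<Sum>j\<le>m + n. h $ j * (Q ^ j) $ m $ n)"
proof -
  have "(\<Sum>j\<le>m + n. fps_const h $ i $ j * (P ^ i * Q ^ j) $ m $ n) =
      (if i = 0 then \<Sum>j\<le>m + n. h $ j * (Q ^ j) $ m $ n else 0)" for i
    by simp
  then show ?thesis by (simp add: subst2_nth)
qed

lemma conj2_subst2_fps_const:
  "conj2 (subst2 (fps_const h) P Q) = subst2 (cnj_second h) P' (conj2 Q)"
  unfolding cnj_second_def
proof (rule series2_eqI)
  fix i j
  have "cnj ((Q ^ k) $ j $ i) = (conj2 Q ^ k) $ i $ j" for k
    by (simp flip: conj2_nth conj2_power)
  then show "conj2 (subst2 (fps_const h) P Q) $ i $ j =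
      subst2 (fps_const (Abs_fps (\<lambda>j. cnj (h $ j)))) P' (conj2 Q) $ i $ j"
    by (simp add: subst2_fps_const_nth add.commute)
qed

text \<open>
  The weight of \<open>(\<zeta> + s z\<^sup>s\<^sup>-\<^sup>1) z\<^sup>i w\<^sup>j\<close> on the surface, in which form the term \<open>z\<^sup>i w\<^sup>j\<close> of the first component
  of a transformation enters the linearized equation.
\<close>

definition tangential_weight :: "nat \<Rightarrow> nat \<Rightarrow> nat \<Rightarrow> nat" where
  "tangential_weight s i j = (if i = 0 then s * j + 1 else i - 1 + s * (j + 1))"

text \<open>
  The linearization of \<open>f \<zeta> + f\<^sup>s + \<phi>(f)\<close> plus its conjugate, rewritten with \<open>z \<zeta> = w - z\<^sup>s - \<zeta>\<^sup>s\<close> as a series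
  in \<open>(z, w)\<close> plus its conjugate. The last two terms are the contributions of \<open>f(0, w)\<close> and of the
  coefficient of \<open>z\<close>, which belong to the other component.
\<close>

definition linear_part :: "nat \<Rightarrow> series2 \<Rightarrow> series2 \<Rightarrow> series2" where
  "linear_part s f \<phi> =
     (var2 + const2 (of_nat (s - 1)) * var1 ^ s) * fps_shift 1 f + \<phi>
     + var1 * cnj_second (f $ 0) - var1 ^ s * cnj_second (f $ 1)"

lemma linear_part_nth:
  "linear_part s f \<phi> $ i $ j =
     (if j = 0 then 0 else f $ (i + 1) $ (j - 1))
     + (if i < s then 0 else of_nat (s - 1) * f $ (i - s + 1) $ j) + \<phi> $ i $ j
     + (if i = 1 then cnj (f $ 0 $ j) else 0) - (if i = s then cnj (f $ 1 $ j) else 0)"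
proof -
  have "(const2 (of_nat (s - 1)) * var1 ^ s * fps_shift 1 f) $ i $ j =
      (if i < s then 0 else of_nat (s - 1) * f $ (i - s + 1) $ j)"
    by (simp add: mult.assoc var1_power_mult_nth del: fps_const_mult)
  then show ?thesis
    by (auto simp: linear_part_def distrib_right var1_power_mult_nth var1_mult_nth var2_mult_nth
        cnj_second_nth)
qed

section \<open>The linearized equation\<close>

text \<open>
  The coefficients of \<open>linear_part\<close> in weight \<open>N = k s + r\<close>: \<open>F j\<close> stands for the coefficient of
  \<open>z\<^sup>i w\<^sup>j\<close> in \<open>f\<close> with \<open>i = N - s (j + 1) + 1\<close>, \<open>x\<close> for that of \<open>w\<^sup>k\<close>, and \<open>y\<close> for that of \<open>z\<^sup>N\<close> in \<open>\<phi>\<close>.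
\<close>

definition chain :: "nat \<Rightarrow> nat \<Rightarrow> nat \<Rightarrow> (nat \<Rightarrow> complex) \<Rightarrow> complex \<Rightarrow> complex \<Rightarrow> nat \<Rightarrow> complex" where
  "chain s k r F x y j =
     (if j = 0 then y else F (j - 1)) + (if j < k then of_nat (s - 1) * F j else 0)
     + (if r = 1 \<and> j = k then cnj x else 0) - (if r = 0 \<and> Suc j = k then cnj (F j) else 0)"

section \<open>The bidiagonal systems in the coefficients of one weight\<close>

lemma of_nat_mult_eq_cnj_imp_0:
  assumes "2 \<le> n" "of_nat n * z = cnj z"
  shows "z = 0"
proof -
  have "real n * cmod z = cmod z"
    by (metis assms(2) complex_mod_cnj norm_mult norm_of_nat)
  then show ?thesis using assms(1) by auto
qed

text \<open>For \<open>r < 2\<close> the unknown \<open>y\<close> is absent and the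
  \<open>F j\<close> are eliminated upwards through the diagonal entry \<open>s - 1\<close>; for
  \<open>r = 0\<close> the last entry is the real-linear map sending \<open>u\<close> to
  \<open>(s - 1) u - cnj u\<close>, injective by comparing moduli. For \<open>r >= 2\<close> the
  equation \<open>j = k\<close> starts an elimination downwards through the entries
  \<open>1\<close>, and equation \<open>0\<close> leaves \<open>y\<close>.\<close>

lemma chain_eq_0:
  assumes s: "3 \<le> s" and k: "1 \<le> k" "r = 0 \<Longrightarrow> 2 \<le> k"
    and 0: "\<And>j. j \<le> k \<Longrightarrow> j < k \<or> r \<noteq> 0 \<Longrightarrow> chain s k r F x y j = 0"
    and y: "r < 2 \<Longrightarrow> y = 0"
  shows "j < k \<Longrightarrow> F j = 0" "r = 1 \<Longrightarrow> x = 0" "y = 0"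
proof -
  have s1: "of_nat (s - 1) \<noteq> (0 :: complex)" using s by simp
  have F: "F j = 0" if "j < k" for j
  proof (cases "r < 2")
    case True
    show ?thesis using that
    proof (induction j)
      case 0
      then show ?case using assms(4)[of 0] k y True s1 by (auto simp: chain_def split: if_splits)
    next
      case (Suc j)
      then have "of_nat (s - 1) * F (Suc j) = (if r = 0 \<and> Suc (Suc j) = k then cnj (F (Suc j)) else 0)"
        using 0[of "Suc j"] by (auto simp: chain_def)
      then show ?case
        using of_nat_mult_eq_cnj_imp_0[of "s - 1" "F (Suc j)"] s s1 by (auto split: if_splits)
    qed
  next
    case False
    have "F (k - 1 - m) = 0" if "m < k" for m using that
    proof (induction m)
      case 0
      then show ?case using assms(4)[of k] False k by (simp add: chain_def)
    next
      case (Suc m)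
      then show ?case using 0[of "k - 1 - m"] False by (simp add: chain_def)
    qed
    from this[of "k - 1 - j"] show ?thesis using that by simp
  qed
  then show "j < k \<Longrightarrow> F j = 0" .
  show "r = 1 \<Longrightarrow> x = 0" using 0[of k] F[of "k - 1"] k by (simp add: chain_def)
  show "y = 0"
    using 0[of 0] F[of 0] k by (cases "r = 0 \<and> k = 1") (auto simp: chain_def)
qed

lemma chain_surject:
  assumes s: "3 \<le> s" and k: "1 \<le> k" "r = 0 \<Longrightarrow> 2 \<le> k"
  shows "\<exists>F x y. (r < 2 \<longrightarrow> y = 0) \<and> (\<forall>j\<le>k. j < k \<or> r \<noteq> 0 \<longrightarrow> chain s k r F x y j = b j)"
proof -
  let ?n = "of_nat (s - 1) :: complex"
  have n: "?n \<noteq> 0" using s by simp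
  consider "2 \<le> r" | "r = 1" | "r = 0" by linarith
  then show ?thesis
  proof cases
    case 1
    \<comment> \<open>The recursion runs downwards from the equation \<open>j = k\<close>:
      \<open>E m\<close> is the unknown with index \<open>k - 1 - m\<close>.\<close>
    define E where "E = rec_nat (b k) (\<lambda>m e. b (k - 1 - m) - ?n * e)"
    have E: "E 0 = b k" "E (Suc m) = b (k - 1 - m) - ?n * E m" for m by (simp_all add: E_def)
    define F where "F = (\<lambda>j. E (k - 1 - j))"
    have "chain s k r F 0 (b 0 - ?n * F 0) j = b j" if "j \<le> k" for j
    proof -
      consider "j = 0" | "j = k" "0 < j" | "0 < j" "j < k" using \<open>j \<le> k\<close> by linarith
      then show ?thesis
      proof cases
        case 3
        then have "k - j = Suc (k - 1 - j)" "k - 1 - (k - 1 - j) = j" by auto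
        then have "F (j - 1) = b j - ?n * F j" using 3 by (simp add: F_def E)
        then show ?thesis using 1 3 by (simp add: chain_def)
      qed (use 1 k in \<open>auto simp: chain_def F_def E\<close>)
    qed
    then show ?thesis using 1 by (intro exI[of _ F] exI[of _ 0] exI[of _ "b 0 - ?n * F 0"]) auto
  next
    case 2
    define E where "E = rec_nat (b 0 / ?n) (\<lambda>m e. (b (Suc m) - e) / ?n)"
    have E: "E 0 = b 0 / ?n" "E (Suc m) = (b (Suc m) - E m) / ?n" for m by (simp_all add: E_def)
    have "chain s k r E (cnj (b k - E (k - 1))) 0 j = b j" if "j \<le> k" for j
      using 2 k n that by (cases j) (auto simp: chain_def E simp del: of_nat_diff)
    then show ?thesis using 2 by (intro exI[of _ E] exI[of _ "cnj (b k - E (k - 1))"] exI[of _ 0]) auto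
  next
    case 3
    define E where "E = rec_nat (b 0 / ?n) (\<lambda>m e. (b (Suc m) - e) / ?n)"
    have E: "E 0 = b 0 / ?n" "E (Suc m) = (b (Suc m) - E m) / ?n" for m by (simp_all add: E_def)
    define c where "c = b (k - 1) - E (k - 2)"
    \<comment> \<open>\<open>X\<close> solves \<open>?n * X - cnj X = c\<close>, obtained by
      eliminating \<open>cnj X\<close> between this equation and its conjugate; \<open>c\<close> is
      what the last equation leaves for the final unknown.\<close>
    define X where "X = (?n * c + cnj c) / (?n\<^sup>2 - 1)"
    have "2 \<le> k" using 3 k by blast
    have "?n\<^sup>2 \<noteq> 1"
    proof -
      have "(s - 1)\<^sup>2 \<noteq> 1" using s by (simp add: power2_eq_square)
      then show ?thesis by (metis of_nat_eq_1_iff of_nat_power)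
    qed
    then have X: "?n * X - cnj X = c"
      by (simp add: X_def divide_simps del: of_nat_diff) (simp add: algebra_simps power2_eq_square)
    have "chain s k r (E(k - 1 := X)) 0 0 j = b j" if "j < k" for j
    proof (cases "j = k - 1")
      case True
      obtain m where m: "k = Suc (Suc m)" using \<open>2 \<le> k\<close> by (metis add_2_eq_Suc le_Suc_ex)
      have "chain s k r (E(k - 1 := X)) 0 0 j = E m + (?n * X - cnj X)"
        using 3 True by (simp add: chain_def m)
      then show ?thesis unfolding X using True by (simp add: c_def m)
    next
      case False
      then show ?thesis
        using 3 n that \<open>2 \<le> k\<close> by (cases j) (auto simp: chain_def E simp del: of_nat_diff)
    qed
    then show ?thesis using 3 by (intro exI[of _ "E(k - 1 := X)"] exI[of _ 0]) auto
  qed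
qed

section \<open>Triangular systems of binomial coefficients\<close>

lemma binomial_sums_eq_0:
  fixes c :: "nat \<Rightarrow> complex"
  assumes "\<And>b. b \<le> k \<Longrightarrow> (\<Sum>j\<le>k. c j * of_nat (j choose b)) = 0" and "j \<le> k"
  shows "c j = 0"
  using assms
proof (induction k arbitrary: j)
  case 0
  then show ?case by simp
next
  case (Suc k)
  have "(\<Sum>j\<le>k. c j * of_nat (j choose Suc k)) = 0" by (intro sum.neutral) simp
  then have top: "c (Suc k) = 0" using Suc.prems(1)[of "Suc k"] by simp
  then have "(\<Sum>j\<le>k. c j * of_nat (j choose b)) = 0" if "b \<le> k" for b
    using Suc.prems(1)[of b] that by simp
  then show ?case using Suc.IH top Suc.prems(2) le_Suc_eq by metis
qed

text \<open>The matrix is triangular with unit diagonal, so the equation \<open>b = k\<close> gives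
  \<open>c k\<close> and the others follow by induction. The value of \<open>c k\<close> is recorded
  because it becomes the coefficient of a pure power of \<open>w\<close> when
  \<open>N = s * k\<close>.\<close>

lemma binomial_sums_exist:
  fixes r :: "nat \<Rightarrow> complex"
  shows "\<exists>c. c k = r k \<and> (\<forall>b\<le>k. (\<Sum>j\<le>k. c j * of_nat (j choose b)) = r b)"
proof (induction k arbitrary: r)
  case 0
  then show ?case by (auto intro: exI[of _ r])
next
  case (Suc k)
  obtain c where c: "\<And>b. b \<le> k \<Longrightarrow>
      (\<Sum>j\<le>k. c j * of_nat (j choose b)) = r b - r (Suc k) * of_nat (Suc k choose b)"
    using Suc[of "\<lambda>b. r b - r (Suc k) * of_nat (Suc k choose b)"] by blast
  define c' where "c' = c(Suc k := r (Suc k))"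
  have "(\<Sum>j\<le>Suc k. c' j * of_nat (j choose b)) = r b" if "b \<le> Suc k" for b
  proof -
    have "(\<Sum>j\<le>k. c' j * of_nat (j choose b)) = (\<Sum>j\<le>k. c j * of_nat (j choose b))"
      by (rule sum.cong) (auto simp: c'_def)
    also have "\<dots> = r b - r (Suc k) * of_nat (Suc k choose b)"
    proof (cases "b = Suc k")
      case True
      then have "(\<Sum>j\<le>k. c j * of_nat (j choose b)) = 0" by (intro sum.neutral) simp
      then show ?thesis using True by simp
    qed (use c that in simp)
    finally show ?thesis by (simp add: c'_def del: binomial_Suc_Suc)
  qed
  then show ?case by (intro exI[of _ c']) (simp add: c'_def)
qed

section \<open>Leading parts of series restricted to the model surface\<close>

context
  fixes s :: nat
  assumes s3: "3 \<le> s"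
begin

text \<open>Filtrations of series in \<open>(z, \<zeta>)\<close>, of series in
  \<open>(z, w)\<close>, and of first components of transformations; \<open>\<sigma>\<close> is
  restriction to the model.\<close>

private abbreviation "\<omega> \<equiv> surface_weight s"
private abbreviation "\<nu> \<equiv> lin_weight 1 s"
private abbreviation "\<tau> \<equiv> tangential_weight s"
private abbreviation "\<sigma> A \<equiv> subst2 A var1 (model s)"

lemma weight_ge_model: "weight_ge \<omega> s (model s)"
proof -
  have "weight_ge \<omega> s (var1 * var2)"
    using weight_ge_monomial[of s \<omega> 1 1] s3 by (simp add: surface_weight_def)
  then show ?thesis
    unfolding model_def
    by (intro weight_ge_add weight_ge_var1_power weight_ge_var2_power)
      (auto simp: surface_weight_def)
qed

lemma model_nth_00 [simp]: "model s $ 0 $ 0 = 0"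
  using s3 by (simp add: model_def var1_def var2_def)

lemma weight_ge_subst2_graph:
  "weight_ge \<omega> s H \<Longrightarrow> weight_ge \<nu> N A \<Longrightarrow> weight_ge \<omega> N (subst2 A var1 H)"
  by (rule subst2_weight[of _ 1 _ s]) (auto intro!: weight_ge_var simp: surface_weight_def)

lemma weight_ge_\<sigma>: "weight_ge \<nu> N A \<Longrightarrow> weight_ge \<omega> N (\<sigma> A)"
  by (rule weight_ge_subst2_graph[OF weight_ge_model])

text \<open>
  The weight \<open>i + (s - 1) j\<close> agrees with the surface weight where \<open>i \<ge> j\<close> and exceeds it elsewhere;
  it is the weight in which \<open>z \<zeta> + z\<^sup>s\<close> is the leading part of the model.
\<close>

lemma surface_weight_ge_eq: "b \<le> a \<Longrightarrow> \<omega> a b = a + (s - 1) * b"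
  using s3 by (simp add: surface_weight_def algebra_simps)

lemma surface_weight_le: "\<omega> a b \<le> lin_weight 1 (s - 1) a b"
proof (cases "b \<le> a")
  case False
  then have "a + b + (s - 2) * a \<le> a + b + (s - 2) * b" by simp
  then show ?thesis using False s3 by (simp add: surface_weight_def lin_weight_def algebra_simps)
qed (simp add: surface_weight_ge_eq lin_weight_def)

lemma weight_ge_lin_weight: "weight_ge \<omega> N A \<Longrightarrow> weight_ge (lin_weight 1 (s - 1)) N A"
  using surface_weight_le by (metis le_less_trans weight_ge_def)

text \<open>In the weight \<open>lin_weight 1 (s - 1)\<close> the leading part of the model is
  \<open>z (\<zeta> + z^(s-1))\<close>, whose powers expand by the binomial theorem.\<close>

lemma model_power_nth:
  assumes "a + (s - 1) * b = s * j"
  shows "(model s ^ j) $ a $ b = of_nat (j choose b)"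
  using assms
proof (induction j arbitrary: a b)
  case 0
  then show ?case using s3 by auto
next
  case (Suc j)
  let ?l = "lin_weight 1 (s - 1)"
  have "weight_ge ?l (j * s) (model s ^ j)"
    by (rule weight_ge_power[OF _ weight_ge_lin_weight[OF weight_ge_model]]) simp
  \<comment> \<open>The term \<open>\<zeta>^s\<close> of the model has weight
    \<open>(s - 1) * s\<close>, at least \<open>2 * s\<close>, so the cofactor would lie below its
    order.\<close>
  then have far: "(model s ^ j) $ a $ (b - s) = 0" if "s \<le> b"
  proof (rule weight_geD)
    have "(s - 1) * (b - s) + (s - 1) * s = (s - 1) * b"
      unfolding distrib_left[symmetric] using that by simp
    then have "a + (s - 1) * (b - s) + (s - 1) * s = s * j + s"
      using Suc.prems by simp
    moreover have "2 * s \<le> (s - 1) * s" using s3 by (intro mult_le_mono1) auto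
    ultimately have "a + (s - 1) * (b - s) < s * j" using s3 by linarith
    then show "?l a (b - s) < j * s" by (simp add: lin_weight_def mult.commute)
  qed
  have "model s ^ Suc j = var1 * (var2 * model s ^ j) + var1 ^ s * model s ^ j + var2 ^ s * model s ^ j"
    by (simp add: model_def algebra_simps)
  then have "(model s ^ Suc j) $ a $ b =
      (if a = 0 \<or> b = 0 then 0 else (model s ^ j) $ (a - 1) $ (b - 1))
      + (if a < s then 0 else (model s ^ j) $ (a - s) $ b)"
    using far by (simp only: fps_add_nth var1_power_mult_nth var2_power_mult_nth var1_mult_nth
        var2_mult_nth) auto
  moreover have "(if a = 0 \<or> b = 0 then 0 else (model s ^ j) $ (a - 1) $ (b - 1)) =
      (if b = 0 then 0 else of_nat (j choose (b - 1)))"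
  proof (cases b)
    case (Suc c)
    \<comment> \<open>For \<open>a = 0\<close> the weight equation forces \<open>c > j\<close>, so
      the binomial coefficient vanishes as well.\<close>
    have "a \<noteq> 0 \<or> j choose c = 0"
    proof (rule ccontr)
      assume "\<not> ?thesis"
      then have "a = 0" "c \<le> j" by (auto simp: binomial_eq_0_iff)
      then have "(s - 1) * Suc c \<le> (s - 1) * Suc j" by simp
      with Suc.prems \<open>a = 0\<close> s3 Suc show False by (simp add: algebra_simps)
    qed
    moreover have "(model s ^ j) $ (a - 1) $ c = of_nat (j choose c)" if "a \<noteq> 0"
    proof (rule Suc.IH)
      have "(s - 1) * b = (s - 1) * c + (s - 1)" using Suc by simp
      then show "a - 1 + (s - 1) * c = s * j" using Suc.prems that s3 by simp
    qed
    ultimately show ?thesis using Suc by auto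
  qed simp
  moreover have "(if a < s then 0 else (model s ^ j) $ (a - s) $ b) = of_nat (j choose b)"
  proof (cases "a < s")
    case True
    have "j < b"
    proof (rule ccontr)
      assume "\<not> j < b"
      then have "(s - 1) * b \<le> (s - 1) * j" by simp
      also have "\<dots> \<le> s * j" by simp
      finally show False using Suc.prems True by simp
    qed
    then show ?thesis using True by simp
  next
    case False
    then show ?thesis using Suc.prems by (simp add: Suc.IH)
  qed
  ultimately show ?case by (cases b) auto
qed

text \<open>Terms of \<open>A\<close> of weight below \<open>N\<close> vanish by hypothesis and
  those above \<open>N\<close> restrict to higher order, so only the line
  \<open>i + s * j = N\<close> contributes.\<close>

lemma \<sigma>_leading_nth:
  assumes A: "weight_ge \<nu> N A" and ab: "a + (s - 1) * b = N"
  shows "\<sigma> A $ a $ b = (\<Sum>j\<le>N div s. A $ (N - s * j) $ j * of_nat (j choose b))"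
proof -
  let ?l = "lin_weight 1 (s - 1)"
  have "b \<le> (s - 1) * b" using s3 by (cases "s - 1") auto
  then have abN: "a + b \<le> N" using ab by linarith
  have summand: "A $ i $ j * (var1 ^ i * model s ^ j) $ a $ b =
      (if i + s * j = N then A $ i $ j * of_nat (j choose b) else 0)" for i j
  proof (cases "i + s * j" N rule: linorder_cases)
    case less
    then show ?thesis using weight_geD[OF A, of i j] by (simp add: lin_weight_def)
  next
    case equal
    have "(var1 ^ i * model s ^ j) $ a $ b = of_nat (j choose b)"
    proof (cases "a < i")
      case True
      then have "s * j < (s - 1) * b" using ab equal by simp
      also have "\<dots> \<le> s * b" by simp
      finally have "j < b" by simp
      then show ?thesis using True by (simp add: var1_power_mult_nth)
    next
      case False
      then show ?thesis using ab equal by (simp add: var1_power_mult_nth model_power_nth)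
    qed
    then show ?thesis using equal by simp
  next
    case greater
    have "weight_ge ?l (i + s * j) (var1 ^ i * model s ^ j)"
      by (rule weight_ge_mult[OF _ weight_ge_var1_power[of i]
            weight_ge_power[OF _ weight_ge_lin_weight[OF weight_ge_model], of j]])
        (auto simp: lin_weight_def mult.commute)
    then show ?thesis using greater ab by (simp add: weight_ge_def lin_weight_def)
  qed
  have "\<sigma> A $ a $ b = (\<Sum>i\<le>N. \<Sum>j\<le>N. if i + s * j = N then A $ i $ j * of_nat (j choose b) else 0)"
    by (simp add: subst2_nth_ge[OF _ _ abN] summand)
  also have "\<dots> = (\<Sum>j\<le>N. \<Sum>i\<le>N. if i + s * j = N then A $ i $ j * of_nat (j choose b) else 0)"
    by (rule sum.swap)
  also have "\<dots> = (\<Sum>j\<le>N. if s * j \<le> N then A $ (N - s * j) $ j * of_nat (j choose b) else 0)"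
  proof (rule sum.cong[OF refl])
    fix j
    have "(\<Sum>i\<le>N. if i + s * j = N then A $ i $ j * of_nat (j choose b) else 0) =
      (\<Sum>i\<le>N. if i = N - s * j then if s * j \<le> N then A $ (N - s * j) $ j * of_nat (j choose b) else 0 else 0)"
      by (rule sum.cong) auto
    then show "(\<Sum>i\<le>N. if i + s * j = N then A $ i $ j * of_nat (j choose b) else 0) =
      (if s * j \<le> N then A $ (N - s * j) $ j * of_nat (j choose b) else 0)" by simp
  qed
  also have "\<dots> = (\<Sum>j\<le>N div s. A $ (N - s * j) $ j * of_nat (j choose b))"
  proof (rule sum.mono_neutral_cong_right)
    show "{..N div s} \<subseteq> {..N}" by (auto intro: le_trans[OF _ div_le_dividend])
  qed (use s3 in \<open>auto simp: less_eq_div_iff_mult_less_eq mult.commute\<close>)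
  finally show ?thesis .
qed

text \<open>On the line of weight \<open>N\<close> the positions with \<open>b <= a\<close> are
  those with \<open>b <= N div s\<close>: as many equations as coefficients of \<open>A\<close>,
  with the binomial matrix.\<close>

lemma \<sigma>_leading_inject:
  assumes A: "weight_ge \<nu> N A"
    and 0: "\<And>a b. b \<le> a \<Longrightarrow> a + (s - 1) * b = N \<Longrightarrow> \<sigma> A $ a $ b = 0"
  shows "weight_ge \<nu> (Suc N) A"
proof -
  have lead: "A $ (N - s * j) $ j = 0" if "j \<le> N div s" for j
  proof (rule binomial_sums_eq_0[of "N div s" "\<lambda>j. A $ (N - s * j) $ j", OF _ that])
    fix b assume "b \<le> N div s"
    then have "b * s \<le> N" using s3 by (simp add: less_eq_div_iff_mult_less_eq)
    moreover have "b * s = b + (s - 1) * b" using s3 by (cases s) auto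
    ultimately have "b \<le> N - (s - 1) * b" "N - (s - 1) * b + (s - 1) * b = N" by auto
    then show "(\<Sum>j\<le>N div s. A $ (N - s * j) $ j * of_nat (j choose b)) = 0"
      using 0[of b "N - (s - 1) * b"] \<sigma>_leading_nth[OF A, of "N - (s - 1) * b" b] by simp
  qed
  have "A $ i $ j = 0" if "i + s * j = N" for i j
  proof -
    have "s * j \<le> N" "i = N - s * j" using that by auto
    then show ?thesis
      using lead[of j] s3 by (simp add: less_eq_div_iff_mult_less_eq mult.commute)
  qed
  then show ?thesis using A by (auto simp: weight_ge_def lin_weight_def less_Suc_eq)
qed

text \<open>The last clause says when no pure power of \<open>w\<close> is used: its coefficient is
  the one of \<open>R\<close> on the diagonal.\<close>

lemma \<sigma>_leading_surject:
  obtains A where "weight_ge \<nu> N A"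
    and "\<And>a b. b \<le> a \<Longrightarrow> a + (s - 1) * b = N \<Longrightarrow> \<sigma> A $ a $ b = R $ a $ b"
    and "(\<And>k. N = s * k \<Longrightarrow> R $ k $ k = 0) \<Longrightarrow> A $ 0 = 0"
proof -
  define k where "k = N div s"
  obtain c where c: "c k = R $ (N - (s - 1) * k) $ k"
    "\<And>b. b \<le> k \<Longrightarrow> (\<Sum>j\<le>k. c j * of_nat (j choose b)) = R $ (N - (s - 1) * b) $ b"
    using binomial_sums_exist[of k "\<lambda>b. R $ (N - (s - 1) * b) $ b"] by blast
  define A where "A = Abs_fps (\<lambda>i. Abs_fps (\<lambda>j. if i + s * j = N then c j else 0))"
  have A: "weight_ge \<nu> N A" by (simp add: A_def weight_ge_def lin_weight_def)
  have sk: "j \<le> k \<longleftrightarrow> s * j \<le> N" for j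
    using s3 by (simp add: k_def less_eq_div_iff_mult_less_eq mult.commute)
  have "\<sigma> A $ a $ b = R $ a $ b" if "b \<le> a" "a + (s - 1) * b = N" for a b
  proof -
    have "b + (s - 1) * b = s * b" using s3 by (cases s) auto
    then have "b \<le> k" unfolding sk using that by linarith
    have "\<sigma> A $ a $ b = (\<Sum>j\<le>k. A $ (N - s * j) $ j * of_nat (j choose b))"
      unfolding k_def by (rule \<sigma>_leading_nth[OF A that(2)])
    also have "\<dots> = (\<Sum>j\<le>k. c j * of_nat (j choose b))"
      by (rule sum.cong) (auto simp: A_def sk)
    finally show ?thesis using c(2)[OF \<open>b \<le> k\<close>] that by auto
  qed
  moreover have "A $ 0 = 0" if "\<And>k. N = s * k \<Longrightarrow> R $ k $ k = 0"
  proof (rule fps_ext)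
    fix j
    have "c j = 0" if N: "s * j = N"
    proof -
      have "k = j" using N s3 by (auto simp: k_def)
      moreover have "N - (s - 1) * j = j" using N s3 by (cases s) auto
      ultimately show ?thesis using c(1) N \<open>\<And>k. N = s * k \<Longrightarrow> R $ k $ k = 0\<close> by simp
    qed
    then show "A $ 0 $ j = 0 $ j" by (simp add: A_def)
  qed
  ultimately show ?thesis using that A by blast
qed

section \<open>The graded decomposition into a series in \<open>(z, w)\<close> and a conjugate
  one\<close>

lemma weight_ge_SucI:
  assumes "weight_ge \<omega> N R"
    and "\<And>a b. b \<le> a \<Longrightarrow> a + (s - 1) * b = N \<Longrightarrow> R $ a $ b = 0"
    and "\<And>a b. b \<le> a \<Longrightarrow> a + (s - 1) * b = N \<Longrightarrow> conj2 R $ a $ b = 0"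
  shows "weight_ge \<omega> (Suc N) R"
  unfolding weight_ge_def
proof (intro allI impI)
  fix i j assume "\<omega> i j < Suc N"
  then consider "\<omega> i j < N" | "\<omega> i j = N" "j \<le> i" | "\<omega> i j = N" "i \<le> j" by linarith
  then show "R $ i $ j = 0"
  proof cases
    case 3
    then have "\<omega> j i = N" by (simp add: surface_weight_def min.commute add.commute)
    then show ?thesis using assms(3)[of i j] 3 surface_weight_ge_eq[of i j] by simp
  qed (use assms surface_weight_ge_eq in \<open>auto simp: weight_ge_def\<close>)
qed

text \<open>The conjugate of a multiple of \<open>z\<close> is a multiple of \<open>\<zeta>\<close>,
  whose weight rises from \<open>1\<close> to \<open>s - 1\<close> in the asymmetric weight. Hence
  the conjugate component is invisible in the leading half \<open>b <= a\<close>.\<close>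

lemma conj2_\<sigma>_leading_nth:
  assumes B: "weight_ge \<nu> N B" "B $ 0 = 0" and ab: "a + (s - 1) * b = N"
  shows "conj2 (\<sigma> B) $ a $ b = 0"
proof -
  let ?l = "lin_weight 1 (s - 1)"
  have B1: "B = var1 * fps_shift 1 B"
    using B(2) by (auto intro!: series2_eqI simp: var1_mult_nth)
  have "weight_ge \<nu> (N - 1) (fps_shift 1 B)"
    using B(1) by (auto simp: weight_ge_def lin_weight_def)
  then have "weight_ge ?l (N - 1) (conj2 (\<sigma> (fps_shift 1 B)))"
    by (intro weight_ge_lin_weight weight_ge_conj2_surface_weight weight_ge_\<sigma>)
  moreover have "conj2 (\<sigma> B) = var2 * conj2 (\<sigma> (fps_shift 1 B))"
    by (subst B1) (simp add: subst2_mult conj2_mult)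
  ultimately have "weight_ge ?l (Suc N) (conj2 (\<sigma> B))"
    using s3 by (auto intro!: weight_ge_mult[OF _ weight_ge_var(2)[of 2]] simp: lin_weight_def)
  then show ?thesis using ab by (simp add: weight_ge_def lin_weight_def)
qed

text \<open>The half \<open>b <= a\<close> sees only \<open>G\<close>; once \<open>G\<close> is
  gone, conjugation exposes \<open>B\<close>. Pure powers of \<open>w\<close> could belong to either
  component; the condition \<open>B $ 0 = 0\<close> assigns them to \<open>G\<close>.\<close>

lemma graded_decomposition_unique:
  assumes G: "weight_ge \<nu> N G" and B: "weight_ge \<nu> N B" "B $ 0 = 0"
    and 0: "weight_ge \<omega> (Suc N) (\<sigma> G - conj2 (\<sigma> B))"
  shows "weight_ge \<nu> (Suc N) G" "weight_ge \<nu> (Suc N) B"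
proof -
  have lead: "(\<sigma> G - conj2 (\<sigma> B)) $ a $ b = 0" if "a + (s - 1) * b = N" for a b
    using weight_geD[OF weight_ge_lin_weight[OF 0], of a b] that by (simp add: lin_weight_def)
  show G': "weight_ge \<nu> (Suc N) G"
    by (rule \<sigma>_leading_inject[OF G]) (use lead conj2_\<sigma>_leading_nth[OF B] in \<open>simp del: conj2_nth\<close>)
  have "weight_ge \<omega> (Suc N) (conj2 (\<sigma> B))"
    using weight_ge_diff[OF weight_ge_\<sigma>[OF G'] 0] by simp
  then have "weight_ge \<omega> (Suc N) (conj2 (conj2 (\<sigma> B)))"
    by (rule weight_ge_conj2_surface_weight)
  then have "weight_ge (lin_weight 1 (s - 1)) (Suc N) (\<sigma> B)"
    by (intro weight_ge_lin_weight) simp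
  then show "weight_ge \<nu> (Suc N) B"
    by (intro \<sigma>_leading_inject[OF B(1)]) (simp add: weight_ge_def lin_weight_def)
qed

text \<open>\<open>G\<close> is chosen to match \<open>R\<close> where \<open>b <= a\<close>. The
  remainder vanishes on the diagonal, which both halves share, so its conjugate is matched by a
  \<open>B\<close> without pure powers of \<open>w\<close>, and this \<open>B\<close> does not
  disturb the first half.\<close>

lemma graded_decomposition_exists:
  assumes R: "weight_ge \<omega> N R"
  obtains G B where "weight_ge \<nu> N G" "weight_ge \<nu> N B" "B $ 0 = 0"
    "weight_ge \<omega> (Suc N) (R - (\<sigma> G - conj2 (\<sigma> B)))"
proof -
  obtain G where G: "weight_ge \<nu> N G"
    "\<And>a b. b \<le> a \<Longrightarrow> a + (s - 1) * b = N \<Longrightarrow> \<sigma> G $ a $ b = R $ a $ b"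
    using \<sigma>_leading_surject[of N R] by blast
  define R' where "R' = \<sigma> G - R"
  have R': "weight_ge \<omega> N R'" unfolding R'_def by (intro weight_ge_diff weight_ge_\<sigma> G R)
  have lead: "R' $ a $ b = 0" if "b \<le> a" "a + (s - 1) * b = N" for a b
    using G(2)[OF that] by (simp add: R'_def)
  obtain B where B: "weight_ge \<nu> N B"
    "\<And>a b. b \<le> a \<Longrightarrow> a + (s - 1) * b = N \<Longrightarrow> \<sigma> B $ a $ b = conj2 R' $ a $ b"
    "(\<And>k. N = s * k \<Longrightarrow> conj2 R' $ k $ k = 0) \<Longrightarrow> B $ 0 = 0"
    using \<sigma>_leading_surject[of N "conj2 R'"] by blast
  have B0: "B $ 0 = 0"
  proof (rule B(3))
    fix k assume "N = s * k"
    then have "k + (s - 1) * k = N" using s3 by (cases s) auto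
    then show "conj2 R' $ k $ k = 0" using lead[of k k] by simp
  qed
  have "weight_ge \<omega> (Suc N) (R' - conj2 (\<sigma> B))"
    using R' B(1,2) B0 lead
    by (intro weight_ge_SucI weight_ge_diff weight_ge_conj2_surface_weight weight_ge_\<sigma>)
      (simp_all add: conj2_\<sigma>_leading_nth conj2_diff del: conj2_nth)
  then have "weight_ge \<omega> (Suc N) (R - (\<sigma> G - conj2 (\<sigma> B)))"
    using weight_ge_uminus by (fastforce simp: R'_def algebra_simps)
  then show ?thesis using that G B B0 by blast
qed

section \<open>The terms of the normal form and the solvability of
  \<open>linear_part\<close>\<close>

definition phi_series :: "(nat \<Rightarrow> complex) \<Rightarrow> series2" where
  "phi_series a = of_first (normal_form_phi s a)"

lemma normal_form_index_iff:
  "(\<exists>k j. 1 \<le> k \<and> 2 \<le> j \<and> j \<le> s - 1 \<and> n = k * s + j) \<longleftrightarrow> s \<le> n \<and> 2 \<le> n mod s"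
proof
  assume "\<exists>k j. 1 \<le> k \<and> 2 \<le> j \<and> j \<le> s - 1 \<and> n = k * s + j"
  then obtain k j where kj: "1 \<le> k" "2 \<le> j" "j \<le> s - 1" "n = k * s + j" by blast
  then have "1 * s \<le> k * s" by (intro mult_le_mono1)
  then have "s \<le> n" using kj by linarith
  moreover have "n mod s = j" using kj s3 by simp
  ultimately show "s \<le> n \<and> 2 \<le> n mod s" using kj by simp
next
  assume n: "s \<le> n \<and> 2 \<le> n mod s"
  have "1 \<le> n div s" using n s3 by (simp add: Suc_le_eq div_greater_zero_iff)
  moreover have "n mod s \<le> s - 1" using s3 mod_less_divisor[of s n] by linarith
  ultimately show "\<exists>k j. 1 \<le> k \<and> 2 \<le> j \<and> j \<le> s - 1 \<and> n = k * s + j"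
    using n by (intro exI[of _ "n div s"] exI[of _ "n mod s"]) simp
qed

lemma phi_series_nth:
  "phi_series a $ i $ j = (if j = 0 \<and> s \<le> i \<and> 2 \<le> i mod s then a i else 0)"
  unfolding phi_series_def of_first_def normal_form_phi_def normal_form_index_iff by simp

lemma weight_ge_linear_part:
  assumes "weight_ge \<tau> N f" "weight_ge \<nu> N \<phi>"
  shows "weight_ge \<nu> N (linear_part s f \<phi>)"
  unfolding weight_ge_def
proof (intro allI impI)
  fix i j assume ij: "\<nu> i j < N"
  have "f $ (i + 1) $ (j - 1) = 0" if "j \<noteq> 0"
    using ij that by (intro weight_geD[OF assms(1)])
      (cases j; simp add: tangential_weight_def lin_weight_def)
  moreover have "f $ (i - s + 1) $ j = 0" if "s \<le> i"
    using ij that by (intro weight_geD[OF assms(1)]) (simp add: tangential_weight_def lin_weight_def)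
  moreover have "f $ 0 $ j = 0" if "i = 1"
    using ij that by (intro weight_geD[OF assms(1)]) (simp add: tangential_weight_def lin_weight_def)
  moreover have "f $ 1 $ j = 0" if "i = s"
    using ij that by (intro weight_geD[OF assms(1)]) (simp add: tangential_weight_def lin_weight_def)
  moreover have "\<phi> $ i $ j = 0" by (rule weight_geD[OF assms(2) ij])
  ultimately show "linear_part s f \<phi> $ i $ j = 0" unfolding linear_part_nth by auto
qed

lemma linear_part_chain:
  assumes N: "s < N" and j: "s * j \<le> N" and \<phi>: "\<And>i j. j \<noteq> 0 \<Longrightarrow> \<phi> $ i $ j = 0"
  shows "linear_part s f \<phi> $ (N - s * j) $ j =
    chain s (N div s) (N mod s) (\<lambda>j. f $ (N - s * (j + 1) + 1) $ j) (f $ 0 $ (N div s)) (\<phi> $ N $ 0) j"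
proof -
  define k where "k = N div s"
  define r where "r = N mod s"
  have N': "N = s * k + r" "r < s" using s3 by (simp_all add: k_def r_def)
  have jk: "j \<le> k" using j s3 by (simp add: k_def less_eq_div_iff_mult_less_eq mult.commute)
  \<comment> \<open>\<open>d\<close> counts the multiples of \<open>s\<close> left in the exponent
    of \<open>z\<close>; all case distinctions of \<open>linear_part_nth\<close> and
    \<open>chain\<close> become conditions on \<open>d\<close> and \<open>r\<close>.\<close>
  define d where "d = k - j"
  have "s * d + s * j = s * k" unfolding distrib_left[symmetric] d_def using jk by simp
  then have d: "N - s * j = s * d + r" using N' by simp
  have "j = k \<longleftrightarrow> d = 0" "j < k \<longleftrightarrow> d > 0" "Suc j = k \<longleftrightarrow> d = 1" using jk by (auto simp: d_def)
  moreover have "s * d + r < s \<longleftrightarrow> d = 0" using N' by (cases d) auto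
  moreover have "s * d + r = 1 \<longleftrightarrow> d = 0 \<and> r = 1" using s3 by (cases d) auto
  moreover have "s * d + r = s \<longleftrightarrow> d = 1 \<and> r = 0"
  proof
    assume *: "s * d + r = s"
    then have "d = 1" using N' s3 by (cases d; cases "d - 1") auto
    then show "d = 1 \<and> r = 0" using * by simp
  qed simp
  moreover have "N - s * (j + 1) = s * d + r - s" using d by simp
  moreover have "N - s * (j - 1 + 1) = s * d + r" if "j \<noteq> 0" using d that by simp
  moreover have "f $ (N - s * (j + 1) + 1) $ j = f $ 1 $ j" if "d = 1" "r = 0" using d that by simp
  ultimately show ?thesis
    unfolding linear_part_nth chain_def k_def[symmetric] r_def[symmetric] d
    using \<phi> N' jk by (auto simp: d_def)
qed

text \<open>The coefficients of weight \<open>N\<close> form the system of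
  \<open>chain_eq_0\<close>. The pure powers of \<open>w\<close>, excluded by
  \<open>i \<noteq> 0\<close>, occur only for \<open>N = s * k\<close> and are the equation
  \<open>j = k\<close> omitted there when \<open>r = 0\<close>.\<close>

lemma linear_part_unique:
  assumes N: "s < N" and f: "weight_ge \<tau> N f" and \<phi>: "weight_ge \<nu> N (phi_series a - phi_series a')"
    and 0: "\<And>i j. i \<noteq> 0 \<Longrightarrow> i + s * j = N \<Longrightarrow> linear_part s f (phi_series a - phi_series a') $ i $ j = 0"
  shows "weight_ge \<tau> (Suc N) f" "weight_ge \<nu> (Suc N) (phi_series a - phi_series a')"
proof -
  let ?\<phi> = "phi_series a - phi_series a'"
  define k where "k = N div s"
  define r where "r = N mod s"
  have N': "N = s * k + r" "r < s" using s3 by (simp_all add: k_def r_def)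
  have k: "1 \<le> k" "r = 0 \<Longrightarrow> 2 \<le> k"
    using N N' s3 by (cases k; cases "k - 1"; auto)+
  let ?F = "\<lambda>j. f $ (N - s * (j + 1) + 1) $ j"
  have \<phi>j: "?\<phi> $ i $ j = 0" if "j \<noteq> 0" for i j
    using that by (simp add: phi_series_nth)
  have ch: "chain s k r ?F (f $ 0 $ k) (?\<phi> $ N $ 0) j = 0" if "j \<le> k" "j < k \<or> r \<noteq> 0" for j
  proof -
    have "s * j \<le> s * k" using that by (intro mult_le_mono2)
    then have j: "s * j \<le> N" using N' by linarith
    have "s * j \<noteq> N"
    proof (cases "j < k")
      case True
      then have "s * j < s * k" using s3 by simp
      then show ?thesis using N' by linarith
    next
      case False
      then show ?thesis using \<open>s * j \<le> s * k\<close> N' that by linarith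
    qed
    then show ?thesis
      using 0[of "N - s * j" j] linear_part_chain[OF N j \<phi>j] j by (simp add: k_def r_def)
  qed
  have y: "r < 2 \<Longrightarrow> ?\<phi> $ N $ 0 = 0" by (simp add: phi_series_nth r_def)
  note zero = chain_eq_0[OF s3 k ch y]
  show "weight_ge \<tau> (Suc N) f"
    unfolding weight_ge_def
  proof (intro allI impI)
    fix i j assume "\<tau> i j < Suc N"
    then consider "\<tau> i j < N" | "\<tau> i j = N" "i = 0" | "\<tau> i j = N" "i \<noteq> 0" by linarith
    then show "f $ i $ j = 0"
    proof cases
      case 2
      then have "N = s * j + 1" by (simp add: tangential_weight_def)
      then have N1: "N = 1 + j * s" by simp
      have "k = j" unfolding k_def N1 using s3 by (subst div_mult_self1) auto
      moreover have "r = 1" unfolding r_def N1 using s3 by (subst mod_mult_self1) auto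
      ultimately show ?thesis using zero(2) 2 by simp
    next
      case 3
      then have "N = i - 1 + s * (j + 1)" by (simp add: tangential_weight_def)
      moreover have "j < k"
        using calculation s3 by (simp add: k_def less_eq_div_iff_mult_less_eq mult.commute Suc_le_eq[symmetric])
      ultimately show ?thesis using zero(1)[of j] 3 by simp
    qed (use f in \<open>auto simp: weight_ge_def\<close>)
  qed
  show "weight_ge \<nu> (Suc N) ?\<phi>"
    unfolding weight_ge_def
  proof (intro allI impI)
    fix i j assume ij: "\<nu> i j < Suc N"
    show "?\<phi> $ i $ j = 0"
    proof (cases "j = 0 \<and> i = N")
      case False
      then show ?thesis using \<phi>j[of j i] weight_geD[OF \<phi>, of i j] ij
        by (cases "j = 0") (auto simp: lin_weight_def)
    qed (use zero(3) in simp)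
  qed
qed

lemma linear_part_surject:
  assumes N: "s < N"
  obtains f a where "weight_ge \<tau> N f" "weight_ge \<nu> N (phi_series a)"
    "\<And>i j. i \<noteq> 0 \<Longrightarrow> i + s * j = N \<Longrightarrow> linear_part s f (phi_series a) $ i $ j = B $ i $ j"
proof -
  define k where "k = N div s"
  define r where "r = N mod s"
  have N': "N = s * k + r" "r < s" using s3 by (simp_all add: k_def r_def)
  have k: "1 \<le> k" "r = 0 \<Longrightarrow> 2 \<le> k"
    using N N' s3 by (cases k; cases "k - 1"; auto)+
  obtain F x y where y: "r < 2 \<Longrightarrow> y = 0" and
    ch: "\<And>j. j \<le> k \<Longrightarrow> j < k \<or> r \<noteq> 0 \<Longrightarrow> chain s k r F x y j = B $ (N - s * j) $ j"
    using chain_surject[OF s3 k, where b = "\<lambda>j. B $ (N - s * j) $ j"] by blast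
  define f where "f = Abs_fps (\<lambda>i. Abs_fps (\<lambda>j. if \<tau> i j = N then if i = 0 then x else F j else 0))"
  define a where "a = (\<lambda>n. if n = N then y else 0)"
  have "linear_part s f (phi_series a) $ i $ j = B $ i $ j" if "i \<noteq> 0" "i + s * j = N" for i j
  proof -
    have j: "s * j \<le> N" "N - s * j = i" using that by auto
    have jk: "j \<le> k" using j s3 by (simp add: k_def less_eq_div_iff_mult_less_eq mult.commute)
    have "j < k \<or> r \<noteq> 0" using jk that N' by (cases "j = k") auto
    have F: "f $ (N - s * (l + 1) + 1) $ l = F l" if "l < k" for l
    proof -
      have "s * (l + 1) \<le> s * k" using that by (intro mult_le_mono2) simp
      then show ?thesis using N' by (simp add: f_def tangential_weight_def)
    qed
    have x: "f $ 0 $ k = x" if "r = 1"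
      using N' that by (simp add: f_def tangential_weight_def)
    have "phi_series a $ N $ 0 = y"
      using y N by (auto simp: phi_series_nth a_def r_def not_le)
    then have "linear_part s f (phi_series a) $ i $ j =
        chain s k r (\<lambda>j. f $ (N - s * (j + 1) + 1) $ j) (f $ 0 $ k) y j"
      using linear_part_chain[OF N j(1), of "phi_series a" f] j
      by (simp add: phi_series_nth k_def r_def)
    also have "\<dots> = chain s k r F x y j"
      using jk F[of j] F[of "j - 1"] x k by (auto simp: chain_def)
    finally show ?thesis using ch[OF jk] \<open>j < k \<or> r \<noteq> 0\<close> j by simp
  qed
  moreover have "weight_ge \<tau> N f" by (simp add: weight_ge_def f_def)
  moreover have "weight_ge \<nu> N (phi_series a)"
    by (simp add: weight_ge_def lin_weight_def phi_series_nth a_def)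
  ultimately show ?thesis using that by blast
qed

section \<open>Estimates for the errors of the linearization\<close>

lemma weight_ge_nth_00: "weight_ge \<omega> s H \<Longrightarrow> H $ 0 $ 0 = 0"
  using s3 by (auto intro!: weight_geD simp: surface_weight_def)

text \<open>The two parts are estimated separately: a factor \<open>\<zeta>\<close> adds weight
  \<open>1\<close> to \<open>f(0, w)\<close>, but turns the factor \<open>z\<close> of the rest into
  \<open>z \<zeta>\<close>, of weight \<open>s\<close>. Hence the orders \<open>N - 1\<close> and
  \<open>N - s\<close>.\<close>

lemma tangential_split:
  assumes "weight_ge \<tau> N f" "s < N"
  shows "f = fps_const (f $ 0) + var1 * fps_shift 1 f"
    and "weight_ge \<nu> (N - 1) (fps_const (f $ 0))" "weight_ge \<nu> (N - s) (fps_shift 1 f)"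
proof -
  show "f = fps_const (f $ 0) + var1 * fps_shift 1 f"
    by (rule series2_eqI) (simp add: var1_mult_nth)
  show "weight_ge \<nu> (N - 1) (fps_const (f $ 0))"
    using weight_geD[OF assms(1), of 0] by (auto simp: weight_ge_def lin_weight_def tangential_weight_def)
  show "weight_ge \<nu> (N - s) (fps_shift 1 f)"
    using weight_geD[OF assms(1)] assms(2) by (auto simp: weight_ge_def lin_weight_def tangential_weight_def)
qed

lemma subst2_tangential_split:
  assumes "weight_ge \<tau> N f" "s < N" "weight_ge \<omega> s H"
  obtains D0 D1 where "subst2 f var1 H = D0 + var1 * D1"
    "weight_ge \<omega> (N - 1) D0" "weight_ge \<omega> (N - s) D1"
proof
  have H0: "H $ 0 $ 0 = 0" by (rule weight_ge_nth_00[OF assms(3)])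
  show "subst2 f var1 H = subst2 (fps_const (f $ 0)) var1 H + var1 * subst2 (fps_shift 1 f) var1 H"
    by (subst tangential_split(1)[OF assms(1,2)]) (simp add: subst2_add subst2_mult H0)
qed (rule weight_ge_subst2_graph[OF assms(3)] tangential_split(2,3)[OF assms(1,2)])+

lemma weight_ge_subst2_tangential:
  assumes "weight_ge \<tau> N f" "s < N" "weight_ge \<omega> s H"
  shows "weight_ge \<omega> (Suc (N - s)) (subst2 f var1 H)"
proof -
  obtain D0 D1 where D: "subst2 f var1 H = D0 + var1 * D1"
    "weight_ge \<omega> (N - 1) D0" "weight_ge \<omega> (N - s) D1"
    using subst2_tangential_split[OF assms] by blast
  have "weight_ge \<omega> (Suc (N - s)) (var1 * D1)"
    by (rule weight_ge_mult[OF _ weight_ge_var(1)[of 1] D(3)])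
      (use s3 in \<open>auto simp: surface_weight_def\<close>)
  moreover have "weight_ge \<omega> (Suc (N - s)) D0"
    using s3 assms(2) by (intro weight_ge_mono[OF D(2)]) auto
  ultimately show ?thesis by (simp add: D(1) weight_ge_add)
qed

text \<open>Tangential order above \<open>s\<close> excludes exactly the monomials \<open>1\<close>
  and \<open>z\<close>; every other one is divisible by \<open>z^2\<close> or by \<open>w\<close>,
  and \<open>w\<close> has weight \<open>s\<close> on the surface.\<close>

lemma tangential_square:
  assumes "weight_ge \<tau> (Suc s) h" "weight_ge \<omega> s H"
  obtains C C0 where "subst2 h var1 H = var1\<^sup>2 * C + C0" "weight_ge \<omega> s C0"
proof
  have H0: "H $ 0 $ 0 = 0" by (rule weight_ge_nth_00[OF assms(2)])
  define q r where "q = Abs_fps (\<lambda>i. fps_const (h $ (i + 2) $ 0))" and "r = Abs_fps (\<lambda>i. fps_shift 1 (h $ i))"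
  have "h $ 0 $ 0 = 0" "h $ 1 $ 0 = 0"
    using s3 by (auto intro!: weight_geD[OF assms(1)] simp: tangential_weight_def)
  then have "h $ i $ j = (var1\<^sup>2 * q + var2 * r) $ i $ j" for i j
    unfolding fps_add_nth var1_power_mult_nth var2_mult_nth
    by (cases i; cases "i - 1"; cases j) (simp_all add: q_def r_def)
  then have "h = var1\<^sup>2 * q + var2 * r"
    by (rule series2_eqI)
  then show "subst2 h var1 H = var1\<^sup>2 * subst2 q var1 H + H * subst2 r var1 H"
    by (simp add: subst2_add subst2_mult subst2_power H0)
  show "weight_ge \<omega> s (H * subst2 r var1 H)"
    by (rule weight_ge_mult_right[OF _ assms(2)]) simp
qed

text \<open>Quadratic errors are of higher weight: where the increment has only order
  \<open>N - s\<close>, its factor \<open>z\<close> meets \<open>\<zeta>^2\<close> or a term of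
  weight \<open>s\<close>, and either product has weight at least \<open>s + 1\<close>.\<close>

lemma weight_ge_mult_conj2:
  assumes "weight_ge \<tau> N f" "s < N" "weight_ge \<tau> (Suc s) h" "weight_ge \<omega> s H"
  shows "weight_ge \<omega> (Suc N) (subst2 f var1 H * conj2 (subst2 h var1 H))"
proof -
  obtain D0 D1 where D: "subst2 f var1 H = D0 + var1 * D1"
    "weight_ge \<omega> (N - 1) D0" "weight_ge \<omega> (N - s) D1"
    using subst2_tangential_split[OF assms(1,2,4)] by blast
  obtain C C0 where C: "subst2 h var1 H = var1\<^sup>2 * C + C0" "weight_ge \<omega> s C0"
    using tangential_square[OF assms(3,4)] by blast
  have C0: "weight_ge \<omega> s (conj2 C0)" by (rule weight_ge_conj2_surface_weight[OF C(2)])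
  have z: "weight_ge \<omega> 1 var1" by (rule weight_ge_var) (simp add: surface_weight_def)
  have \<zeta>2: "weight_ge \<omega> 2 (var2\<^sup>2)"
    by (rule weight_ge_var2_power) (simp add: surface_weight_def)
  have 1: "weight_ge \<omega> (Suc N) (D0 * (var2\<^sup>2 * conj2 C))"
    by (rule weight_ge_mult[OF _ D(2) weight_ge_mult_right(1)[OF _ \<zeta>2]]) (use assms(2) in auto)
  have 2: "weight_ge \<omega> (Suc N) (D0 * conj2 C0)"
    by (rule weight_ge_mult[OF _ D(2) C0]) (use s3 assms(2) in auto)
  have z\<zeta>2: "weight_ge \<omega> (Suc s) (var1 * var2\<^sup>2)"
    using weight_ge_monomial[of "Suc s" \<omega> 1 2] s3 by (simp add: surface_weight_def)
  have "weight_ge \<omega> (Suc N) (D1 * (var1 * var2\<^sup>2 * conj2 C))"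
    by (rule weight_ge_mult[OF _ D(3) weight_ge_mult_right(1)[OF _ z\<zeta>2]]) (use assms(2) in auto)
  moreover have "weight_ge \<omega> (Suc N) (D1 * (var1 * conj2 C0))"
    by (rule weight_ge_mult[OF _ D(3) weight_ge_mult[OF _ z C0, of "Suc s"]]) (use assms(2) in auto)
  moreover have "subst2 f var1 H * conj2 (subst2 h var1 H) =
      D0 * (var2\<^sup>2 * conj2 C) + D0 * conj2 C0 + (D1 * (var1 * var2\<^sup>2 * conj2 C) + D1 * (var1 * conj2 C0))"
    unfolding C D by (simp add: conj2_add conj2_mult conj2_power algebra_simps)
  ultimately show ?thesis using 1 2 by (simp add: weight_ge_add)
qed

lemma weight_ge_subst2_graph_diff:
  assumes "weight_ge \<nu> N A" "weight_ge \<omega> s H" "weight_ge \<omega> (Suc s) (H - model s)"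
  shows "weight_ge \<omega> (Suc N) (subst2 A var1 H - \<sigma> A)"
  using subst2_weight_diff[of \<omega> 1 var1 var1 1 s H "model s" N A] assms weight_ge_model
  by (simp add: weight_ge_var surface_weight_def)

text \<open>The error \<open>e1\<close> has order only \<open>N - s + 1\<close>, but the factor
  turns \<open>var1 * e1\<close> into multiples of \<open>z \<zeta>\<close> and \<open>z^s\<close>,
  both of weight \<open>s\<close>.\<close>

lemma weight_ge_linearization_graph:
  assumes f: "weight_ge \<tau> N f" "s < N" and H: "weight_ge \<omega> s H" "weight_ge \<omega> (Suc s) (H - model s)"
  shows "weight_ge \<omega> (Suc N)
    ((var2 + const2 (of_nat s) * var1 ^ (s - 1)) * (subst2 f var1 H - \<sigma> f))"
proof -
  define e0 where "e0 = subst2 (fps_const (f $ 0)) var1 H - \<sigma> (fps_const (f $ 0))"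
  define e1 where "e1 = subst2 (fps_shift 1 f) var1 H - \<sigma> (fps_shift 1 f)"
  have H0: "H $ 0 $ 0 = 0" by (rule weight_ge_nth_00[OF H(1)])
  have e0: "weight_ge \<omega> N e0"
    using weight_ge_subst2_graph_diff[OF tangential_split(2)[OF f] H] f(2) by (simp add: e0_def)
  have e1: "weight_ge \<omega> (Suc (N - s)) e1"
    using weight_ge_subst2_graph_diff[OF tangential_split(3)[OF f] H] by (simp add: e1_def)
  have "subst2 f var1 H - \<sigma> f = e0 + var1 * e1"
    by (subst (1 2) tangential_split(1)[OF f])
      (simp add: e0_def e1_def subst2_add subst2_mult H0 algebra_simps)
  moreover have "var1 ^ (s - 1) * var1 = var1 ^ s" using s3 by (simp flip: power_Suc2)
  ultimately have "(var2 + const2 (of_nat s) * var1 ^ (s - 1)) * (subst2 f var1 H - \<sigma> f) =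
      var2 * e0 + var1 * var2 * e1 + const2 (of_nat s) * (var1 ^ (s - 1) * e0 + var1 ^ s * e1)"
    by (simp add: algebra_simps)
  moreover have "weight_ge \<omega> (Suc N) (var2 * e0)"
    by (rule weight_ge_mult[OF _ weight_ge_var(2)[of 1] e0]) (auto simp: surface_weight_def)
  moreover have z\<zeta>: "weight_ge \<omega> s (var1 * var2)"
    using weight_ge_monomial[of s \<omega> 1 1] s3 by (simp add: surface_weight_def)
  have "weight_ge \<omega> (Suc N) (var1 * var2 * e1)"
    by (rule weight_ge_mult[OF _ z\<zeta> e1]) (use f(2) in auto)
  moreover have "weight_ge \<omega> (Suc N) (var1 ^ (s - 1) * e0)"
    by (rule weight_ge_mult[OF _ weight_ge_var1_power[of 1] e0]) (use s3 in \<open>auto simp: surface_weight_def\<close>)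
  moreover have "weight_ge \<omega> (Suc N) (var1 ^ s * e1)"
    by (rule weight_ge_mult[OF _ weight_ge_var1_power[of s] e1])
      (use s3 f(2) in \<open>auto simp: surface_weight_def\<close>)
  ultimately show ?thesis by (simp add: weight_ge_add weight_ge_const2_mult)
qed

lemma conj2_\<sigma>_cnj_second: "conj2 (\<sigma> (cnj_second h)) = \<sigma> (fps_const h)"
  using conj2_subst2_fps_const[of h var1 "model s" var1] by (metis conj2_conj2 conj2_model)

text \<open>
  Here \<open>z \<zeta>\<close> is traded for \<open>w - z\<^sup>s - \<zeta>\<^sup>s\<close>: modulo higher weight the linearized equation only involves
  series in \<open>(z, w)\<close> and their conjugates.
\<close>

lemma weight_ge_linearization_model:
  assumes f: "weight_ge \<tau> N f" "s < N"
  shows "weight_ge \<omega> (Suc N)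
    ((var2 + const2 (of_nat s) * var1 ^ (s - 1)) * \<sigma> f + \<sigma> \<phi>
      + conj2 ((var2 + const2 (of_nat s) * var1 ^ (s - 1)) * \<sigma> f + \<sigma> \<phi>)
      - (\<sigma> (linear_part s f \<phi>) + conj2 (\<sigma> (linear_part s f \<phi>))))"
proof -
  define f0 where "f0 = \<sigma> (fps_const (f $ 0))"
  define f1 where "f1 = \<sigma> (fps_shift 1 f)"
  define f2 where "f2 = \<sigma> (fps_shift 2 f)"
  define f10 where "f10 = \<sigma> (fps_const (f $ 1))"
  define Z where "Z = var1 ^ (s - 1)"
  have Z: "var1 ^ s = var1 * Z" using s3 by (simp add: Z_def flip: power_Suc)
  have f_eq: "\<sigma> f = f0 + var1 * f1"
    by (subst tangential_split(1)[OF f]) (simp add: f0_def f1_def subst2_add subst2_mult)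
  \<comment> \<open>Trading \<open>z \<zeta>\<close> produces \<open>- \<zeta>^s * f1\<close>.
    Splitting \<open>f1\<close> isolates its leading part \<open>f10\<close>, the source of the last
    term of \<open>linear_part\<close>; the rest carries \<open>z \<zeta>^s\<close> and is an
    error.\<close>
  have "fps_shift 1 f = fps_const (f $ 1) + var1 * fps_shift 2 f"
    by (rule series2_eqI) (auto simp: var1_mult_nth)
  then have f1_eq: "f1 = f10 + var1 * f2"
    by (simp add: f1_def f10_def f2_def subst2_add subst2_mult)
  define U where "U = (var2 + const2 (of_nat (s - 1)) * var1 ^ s) * fps_shift 1 f"
  define V where "V = var1 * cnj_second (f $ 0) - var1 ^ s * cnj_second (f $ 1)"
  define err where "err = const2 (of_nat s) * (Z * f0) - var1 * var2 ^ s * f2"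
  have U: "\<sigma> U = (model s + const2 (of_nat (s - 1)) * var1 ^ s) * f1"
    by (simp add: U_def f1_def subst2_add subst2_mult subst2_power)
  have V: "conj2 (\<sigma> V) = var2 * f0 - var2 ^ s * f10"
    by (simp add: V_def f0_def f10_def subst2_diff subst2_mult subst2_power conj2_diff conj2_mult
        conj2_power conj2_\<sigma>_cnj_second)
  have "const2 (of_nat s) = const2 (of_nat (s - 1)) + 1"
    using s3 const2_simps(3)[of "of_nat (s - 1)" 1] by (simp add: of_nat_diff del: const2_simps(3))
  then have main: "(var2 + const2 (of_nat s) * Z) * \<sigma> f = \<sigma> U + conj2 (\<sigma> V) + err"
    unfolding U V f_eq err_def f1_eq unfolding model_def Z by (simp add: algebra_simps)
  have "linear_part s f \<phi> = U + \<phi> + V"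
    by (simp add: linear_part_def U_def V_def)
  then have "(var2 + const2 (of_nat s) * Z) * \<sigma> f + \<sigma> \<phi>
      + conj2 ((var2 + const2 (of_nat s) * Z) * \<sigma> f + \<sigma> \<phi>)
      - (\<sigma> (linear_part s f \<phi>) + conj2 (\<sigma> (linear_part s f \<phi>))) = err + conj2 err"
    unfolding main by (simp add: subst2_add conj2_add)
  moreover have "weight_ge \<omega> (Suc N) (Z * f0)"
    unfolding Z_def f0_def
    by (rule weight_ge_mult[OF _ weight_ge_var1_power[of 2] weight_ge_\<sigma>[OF tangential_split(2)[OF f]]])
      (use s3 f(2) in \<open>auto simp: surface_weight_def\<close>)
  moreover have "weight_ge \<nu> (N - s - 1) (fps_shift 2 f)"
    using tangential_split(3)[OF f] by (auto simp: weight_ge_def lin_weight_def numeral_2_eq_2)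
  then have "weight_ge \<omega> (Suc N) (var1 * var2 ^ s * f2)"
    unfolding f2_def
    by (intro weight_ge_mult[OF _ weight_ge_monomial[of "s + 2" _ 1 s, simplified] weight_ge_\<sigma>])
      (use s3 f(2) in \<open>auto simp: surface_weight_def\<close>)
  ultimately show ?thesis
    unfolding Z_def[symmetric]
    by (simp add: err_def weight_ge_add weight_ge_diff weight_ge_const2_mult weight_ge_conj2_surface_weight)
qed

text \<open>As these series involve \<open>z\<close> alone, \<open>model s\<close> can serve as
  second argument; its weight \<open>s\<close> fits the estimates for substitution.\<close>

lemma subst2_phi_series: "subst2 (phi_series a) P Q = subst2 (phi_series a) P Q'"
  by (rule series2_eqI)
    (auto simp: subst2_nth phi_series_nth sum.If_cases intro!: sum.cong)

lemma weight_ge_phi_series: "weight_ge \<nu> (Suc s) (phi_series a)"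
  using s3 by (auto simp: weight_ge_def lin_weight_def phi_series_nth less_Suc_eq)

lemma weight_ge_subst2_var1_diff:
  assumes "weight_ge \<tau> (Suc s) (f - var1)" "weight_ge \<omega> s H"
  shows "weight_ge \<omega> 2 (subst2 f var1 H - var1)"
proof -
  have H0: "H $ 0 $ 0 = 0" by (rule weight_ge_nth_00[OF assms(2)])
  obtain C C0 where C: "subst2 (f - var1) var1 H = var1\<^sup>2 * C + C0" "weight_ge \<omega> s C0"
    using tangential_square[OF assms] by blast
  have "weight_ge \<omega> 2 (var1\<^sup>2 * C)"
    by (intro weight_ge_mult_right weight_ge_var1_power) (auto simp: surface_weight_def)
  moreover have "weight_ge \<omega> 2 C0" using s3 by (intro weight_ge_mono[OF C(2)]) auto
  ultimately show ?thesis using C(1) H0 by (simp add: subst2_diff weight_ge_add)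
qed

section \<open>The normalization equation and its first variation\<close>

definition residual :: "series2 \<Rightarrow> series2 \<Rightarrow> series2 \<Rightarrow> (nat \<Rightarrow> complex) \<Rightarrow> series2" where
  "residual H f g a = subst2 g var1 H
     - subst2 (normal_form s a) (subst2 f var1 H) (conj2 (subst2 f var1 H))"

lemma maps_graph_iff_residual: "maps_graph (f, g) H (normal_form s a) \<longleftrightarrow> residual H f g a = 0"
  by (simp add: maps_graph_def residual_def)

lemma residual_expand:
  assumes "subst2 f var1 H = P" "P $ 0 $ 0 = 0"
  shows "residual H f g a = subst2 g var1 H
    - (P * conj2 P + (P ^ s + subst2 (phi_series a) P (model s))
       + conj2 (P ^ s + subst2 (phi_series a) P (model s)))"
proof -
  have "subst2 (conj2 (phi_series a)) P (conj2 P) = conj2 (subst2 (phi_series a) P (model s))"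
    by (subst subst2_phi_series[of _ _ _ "conj2 P"]) (simp add: conj2_subst2)
  moreover have "subst2 (phi_series a) P (conj2 P) = subst2 (phi_series a) P (model s)"
    by (rule subst2_phi_series)
  moreover have "normal_form s a = var1 * var2 + var1 ^ s + var2 ^ s + phi_series a + conj2 (phi_series a)"
    by (simp add: normal_form_def phi_series_def)
  ultimately show ?thesis
    using assms by (simp add: residual_def subst2_add subst2_mult subst2_power conj2_add conj2_power)
qed

text \<open>Each term is replaced by its first variation at the identity on the model. The errors
  \<open>e1\<close> to \<open>e6\<close> come from the Hermitian product, the power
  \<open>s\<close>, the series \<open>\<phi>\<close>, the passage from \<open>H\<close> to the model
  in \<open>f\<close>, the trade of \<open>z \<zeta>\<close>, and that passage in
  \<open>g\<close>.\<close>

lemma weight_ge_residual_diff: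
  assumes H: "weight_ge \<omega> s H" "weight_ge \<omega> (Suc s) (H - model s)"
    and f: "weight_ge \<tau> (Suc s) (f - var1)" and f': "weight_ge \<tau> (Suc s) (f' - var1)"
    and N: "s < N" and df: "weight_ge \<tau> N (f - f')" and dg: "weight_ge \<nu> N (g - g')"
    and da: "weight_ge \<nu> N (phi_series a - phi_series a')"
  defines "T \<equiv> linear_part s (f - f') (phi_series a - phi_series a')"
  shows "weight_ge \<omega> (Suc N)
    (residual H f g a - residual H f' g' a' - (\<sigma> (g - g' - T) - conj2 (\<sigma> T)))"
proof -
  have H0: "H $ 0 $ 0 = 0" by (rule weight_ge_nth_00[OF H(1)])
  define P where "P = subst2 f var1 H"
  define P' where "P' = subst2 f' var1 H"
  define c where "c = var2 + const2 (of_nat s) * var1 ^ (s - 1)"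
  define \<delta>\<phi> where "\<delta>\<phi> = phi_series a - phi_series a'"
  define d where "d = subst2 (f - f') var1 H"
  define S where "S = P ^ s + subst2 (phi_series a) P (model s)"
  define S' where "S' = P' ^ s + subst2 (phi_series a') P' (model s)"
  have d_eq: "d = P - P'" by (simp add: d_def P_def P'_def subst2_diff)
  have z: "weight_ge \<omega> 1 var1" by (rule weight_ge_var) (simp add: surface_weight_def)
  have P2: "weight_ge \<omega> 2 (P - var1)" "weight_ge \<omega> 2 (P' - var1)"
    using weight_ge_subst2_var1_diff[OF f H(1)] weight_ge_subst2_var1_diff[OF f' H(1)]
    by (simp_all add: P_def P'_def)
  have P1: "weight_ge \<omega> 1 P" "weight_ge \<omega> 1 P'"
    using weight_ge_add[OF z weight_ge_mono[OF P2(1)]] weight_ge_add[OF z weight_ge_mono[OF P2(2)]]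
    by simp_all
  have P0: "P $ 0 $ 0 = 0" "P' $ 0 $ 0 = 0"
    using weight_geD[OF P1(1), of 0 0] weight_geD[OF P1(2), of 0 0] by (simp_all add: surface_weight_def)
  have d: "weight_ge \<omega> (1 + (N - s)) (P - P')"
    using weight_ge_subst2_tangential[OF df N H(1)] by (simp add: d_eq flip: d_def)

  \<comment> \<open>The difference of the products is \<open>d * conj2 P + P' * conj2 d\<close>;
    replacing \<open>conj2 P\<close> by \<open>var2\<close> and \<open>P'\<close> by
    \<open>var1\<close> leaves \<open>e1\<close>.\<close>
  define e1 where "e1 = d * conj2 (subst2 (f - var1) var1 H) + conj2 (d * conj2 (subst2 (f' - var1) var1 H))"
  have "weight_ge \<omega> (Suc N) e1"
    unfolding e1_def d_def
    by (intro weight_ge_add weight_ge_conj2_surface_weight weight_ge_mult_conj2 df N f f' H(1))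
  moreover have e1: "P * conj2 P - P' * conj2 P' = var2 * d + conj2 (var2 * d) + e1"
    by (simp add: e1_def subst2_diff H0 conj2_add conj2_diff conj2_mult d_eq algebra_simps flip: P_def P'_def)

  \<comment> \<open>The difference of powers is \<open>d\<close> times \<open>s\<close> products of
    \<open>s - 1\<close> factors \<open>P\<close> or \<open>P'\<close>. Each equals
    \<open>var1 ^ (s - 1)\<close> up to order \<open>s\<close>, and \<open>d\<close> has order
    \<open>N - s + 1\<close>.\<close>
  moreover define e2 where "e2 = P ^ s - P' ^ s - const2 (of_nat s) * var1 ^ (s - 1) * d"
  have "weight_ge \<omega> (Suc N) e2"
  proof -
    have "P' ^ (s - Suc t) * P ^ t - var1 ^ (s - 1) = P' ^ (s - Suc t) * P ^ t - var1 ^ (s - Suc t) * var1 ^ t"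
      if "t < s" for t using that by (simp flip: power_add)
    then have "weight_ge \<omega> s (P' ^ (s - Suc t) * P ^ t - var1 ^ (s - 1))" if "t < s" for t
      using weight_ge_power_mult_diff[of \<omega> 1 P' var1 1 1 P var1 "s - Suc t" t] P1 P2 z that
      by (simp add: numeral_2_eq_2)
    then have "weight_ge \<omega> s (\<Sum>t<s. P' ^ (s - Suc t) * P ^ t - var1 ^ (s - 1))"
      by (intro weight_ge_sum) simp
    moreover have "const2 (of_nat s) = of_nat s"
      by (simp add: const2_def fps_of_nat)
    then have "e2 = (P - P') * (\<Sum>t<s. P' ^ (s - Suc t) * P ^ t - var1 ^ (s - 1))"
      by (simp add: e2_def power_diff_sumr2[of P s P'] d_eq sum_subtractf algebra_simps)
    ultimately show ?thesis
      using N by (auto intro: weight_ge_mult[OF _ d])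
  qed

  moreover define e3 where
    "e3 = subst2 (phi_series a) P (model s) - subst2 (phi_series a') P' (model s) - \<sigma> \<delta>\<phi>"
  have "weight_ge \<omega> (Suc N) e3"
  proof -
    have "weight_ge \<omega> (N + 1) (subst2 \<delta>\<phi> P (model s) - \<sigma> \<delta>\<phi>)"
      using P1 P2 z da by (intro subst2_weight_diff[of _ 1 _ _ _ s])
        (auto simp: weight_ge_model \<delta>\<phi>_def numeral_2_eq_2)
    moreover have "weight_ge \<omega> (Suc s + (N - s))
        (subst2 (phi_series a') P (model s) - subst2 (phi_series a') P' (model s))"
      using P1 d by (intro subst2_weight_diff[of _ 1 _ _ _ s] weight_ge_phi_series)
        (auto simp: weight_ge_model)
    ultimately have "weight_ge \<omega> (Suc N) ((subst2 \<delta>\<phi> P (model s) - \<sigma> \<delta>\<phi>)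
        + (subst2 (phi_series a') P (model s) - subst2 (phi_series a') P' (model s)))"
      using N by (intro weight_ge_add) auto
    then show ?thesis by (simp add: e3_def \<delta>\<phi>_def subst2_diff algebra_simps)
  qed

  moreover define e4 where "e4 = c * (d - \<sigma> (f - f'))"
  have "weight_ge \<omega> (Suc N) e4"
    using weight_ge_linearization_graph[OF df N H] by (simp add: e4_def c_def d_def)

  moreover define e5 where "e5 = c * \<sigma> (f - f') + \<sigma> \<delta>\<phi> + conj2 (c * \<sigma> (f - f') + \<sigma> \<delta>\<phi>)
      - (\<sigma> T + conj2 (\<sigma> T))"
  have "weight_ge \<omega> (Suc N) e5"
    using weight_ge_linearization_model[OF df N] by (simp add: e5_def c_def T_def \<delta>\<phi>_def)

  moreover define e6 where "e6 = subst2 (g - g') var1 H - \<sigma> (g - g')"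
  have "weight_ge \<omega> (Suc N) e6"
    unfolding e6_def by (rule weight_ge_subst2_graph_diff[OF dg H])

  moreover have "S - S' = const2 (of_nat s) * var1 ^ (s - 1) * d + \<sigma> \<delta>\<phi> + e2 + e3"
    by (simp add: S_def S'_def e2_def e3_def)
  then have "S - S' + var2 * d = c * \<sigma> (f - f') + \<sigma> \<delta>\<phi> + e2 + e3 + e4"
    by (simp add: e4_def c_def algebra_simps)
  then have "S + var2 * d = S' + (c * \<sigma> (f - f') + \<sigma> \<delta>\<phi> + e2 + e3 + e4)"
    by (simp add: algebra_simps)
  then have S: "S = S' + (c * \<sigma> (f - f') + \<sigma> \<delta>\<phi> + e2 + e3 + e4) - var2 * d"
    by (simp add: eq_diff_eq)
  have "residual H f g a - residual H f' g' a' = subst2 (g - g') var1 H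
      - (P * conj2 P - P' * conj2 P') - (S + conj2 S - (S' + conj2 S'))"
    using residual_expand[OF P_def[symmetric] P0(1)] residual_expand[OF P'_def[symmetric] P0(2)]
    by (simp add: S_def S'_def subst2_diff)
  then have "residual H f g a - residual H f' g' a' - (\<sigma> (g - g' - T) - conj2 (\<sigma> T)) =
      e6 - e1 - (e2 + e3 + e4) - conj2 (e2 + e3 + e4) - e5"
    unfolding e1 S by (simp add: e5_def e6_def subst2_diff conj2_add conj2_diff)
  ultimately show ?thesis
    by (simp add: weight_ge_add weight_ge_diff weight_ge_conj2_surface_weight)
qed

section \<open>Solving the linearized equation in one weight\<close>

lemma weight_ge_linearization:
  assumes "weight_ge \<tau> N f" "weight_ge \<nu> N g" "weight_ge \<nu> N \<phi>"
  shows "weight_ge \<omega> N (\<sigma> (g - linear_part s f \<phi>) - conj2 (\<sigma> (linear_part s f \<phi>)))"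
  by (intro weight_ge_diff weight_ge_conj2_surface_weight weight_ge_\<sigma> weight_ge_linear_part assms)

text \<open>Moves the pure powers of \<open>w\<close> in \<open>T\<close> to the first component,
  where their conjugates are again series in \<open>w\<close>; the second then satisfies the
  condition of the graded decomposition.\<close>

lemma linearization_split:
  "\<sigma> (g - T) - conj2 (\<sigma> T) =
    \<sigma> (g - T - cnj_second (T $ 0)) - conj2 (\<sigma> (T - fps_const (T $ 0)))"
proof -
  have "conj2 (\<sigma> (fps_const (T $ 0))) = \<sigma> (cnj_second (T $ 0))"
    using conj2_\<sigma>_cnj_second[of "T $ 0"] by (metis conj2_conj2)
  then show ?thesis by (simp add: subst2_diff conj2_diff)
qed

lemma weight_ge_cnj_second:
  "weight_ge \<nu> N T \<Longrightarrow> weight_ge \<nu> N (cnj_second (T $ 0))"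
  "weight_ge \<nu> N T \<Longrightarrow> weight_ge \<nu> N (fps_const (T $ 0))"
  by (auto simp: weight_ge_def cnj_second_nth)

lemma linearization_unique:
  assumes N: "s < N" and f: "weight_ge \<tau> N f" and g: "weight_ge \<nu> N g"
    and a: "weight_ge \<nu> N (phi_series a - phi_series a')"
    and T: "T = linear_part s f (phi_series a - phi_series a')"
    and 0: "weight_ge \<omega> (Suc N) (\<sigma> (g - T) - conj2 (\<sigma> T))"
  shows "weight_ge \<tau> (Suc N) f" "weight_ge \<nu> (Suc N) g"
    "weight_ge \<nu> (Suc N) (phi_series a - phi_series a')"
proof -
  have TN: "weight_ge \<nu> N T" unfolding T by (rule weight_ge_linear_part[OF f a])
  have GN: "weight_ge \<nu> N (g - T - cnj_second (T $ 0))"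
    by (intro weight_ge_diff weight_ge_cnj_second g TN)
  have BN: "weight_ge \<nu> N (T - fps_const (T $ 0))" "(T - fps_const (T $ 0)) $ 0 = 0"
    using weight_ge_diff[OF TN weight_ge_cnj_second(2)[OF TN]] by simp_all
  note u = graded_decomposition_unique[OF GN BN 0[unfolded linearization_split]]
  note G = u(1) and B = u(2)
  have "linear_part s f (phi_series a - phi_series a') $ i $ j = 0" if "i \<noteq> 0" "i + s * j = N" for i j
    using weight_geD[OF B, of i j] that by (simp add: lin_weight_def T)
  from linear_part_unique[OF N f a this]
  show f': "weight_ge \<tau> (Suc N) f" and a': "weight_ge \<nu> (Suc N) (phi_series a - phi_series a')"
    by blast+
  have T': "weight_ge \<nu> (Suc N) T" unfolding T by (rule weight_ge_linear_part[OF f' a'])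
  have "weight_ge \<nu> (Suc N) ((g - T - cnj_second (T $ 0)) + T + cnj_second (T $ 0))"
    by (intro weight_ge_add G T' weight_ge_cnj_second)
  then show "weight_ge \<nu> (Suc N) g" by simp
qed

text \<open>\<open>f\<close> and \<open>\<phi>\<close> are found first, from the conjugate component
  \<open>B\<close>; whatever they contribute to the other component is absorbed by
  \<open>g\<close>.\<close>

lemma linearization_surject:
  assumes N: "s < N" and R: "weight_ge \<omega> N R"
  obtains f g a T where "weight_ge \<tau> N f" "weight_ge \<nu> N g" "weight_ge \<nu> N (phi_series a)"
    "T = linear_part s f (phi_series a)" "weight_ge \<omega> (Suc N) (R - (\<sigma> (g - T) - conj2 (\<sigma> T)))"
proof -
  obtain G B where GB: "weight_ge \<nu> N G" "weight_ge \<nu> N B" "B $ 0 = 0"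
    "weight_ge \<omega> (Suc N) (R - (\<sigma> G - conj2 (\<sigma> B)))"
    using graded_decomposition_exists[OF R] by blast
  obtain f a where fa: "weight_ge \<tau> N f" "weight_ge \<nu> N (phi_series a)"
    "\<And>i j. i \<noteq> 0 \<Longrightarrow> i + s * j = N \<Longrightarrow> linear_part s f (phi_series a) $ i $ j = B $ i $ j"
    using linear_part_surject[OF N, of B] by blast
  define T where "T = linear_part s f (phi_series a)"
  have T: "weight_ge \<nu> N T" unfolding T_def by (rule weight_ge_linear_part[OF fa(1,2)])
  define g where "g = G + T + cnj_second (T $ 0)"
  have "weight_ge \<nu> (Suc N) (T - fps_const (T $ 0) - B)"
    unfolding weight_ge_def
  proof (intro allI impI)
    fix i j assume "\<nu> i j < Suc N"
    then consider "i = 0" | "i \<noteq> 0" "\<nu> i j < N" | "i \<noteq> 0" "i + s * j = N"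
      by (auto simp: lin_weight_def less_Suc_eq)
    then show "(T - fps_const (T $ 0) - B) $ i $ j = 0"
      by cases (use GB(3) fa(3) weight_geD[OF T] weight_geD[OF GB(2)] in \<open>auto simp: T_def\<close>)
  qed
  then have "weight_ge \<omega> (Suc N) (conj2 (\<sigma> (T - fps_const (T $ 0) - B)))"
    by (intro weight_ge_conj2_surface_weight weight_ge_\<sigma>)
  from weight_ge_add[OF GB(4) this]
  have "weight_ge \<omega> (Suc N) (R - (\<sigma> G - conj2 (\<sigma> (T - fps_const (T $ 0)))))"
    unfolding subst2_diff conj2_diff by (simp add: algebra_simps)
  moreover have "g - T - cnj_second (T $ 0) = G" by (simp add: g_def)
  ultimately have "weight_ge \<omega> (Suc N) (R - (\<sigma> (g - T) - conj2 (\<sigma> T)))"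
    unfolding linearization_split by simp
  moreover have "weight_ge \<nu> N g"
    unfolding g_def by (intro weight_ge_add GB(1) T weight_ge_cnj_second)
  ultimately show ?thesis using that fa T_def by blast
qed

section \<open>Normalizations with leading part the identity, first jets and rotations\<close>

lemma normalization_unique:
  assumes H: "weight_ge \<omega> s H" "weight_ge \<omega> (Suc s) (H - model s)"
    and f: "weight_ge \<tau> (Suc s) (f - var1)" and f': "weight_ge \<tau> (Suc s) (f' - var1)"
    and g: "weight_ge \<nu> (Suc s) (g - var2)" and g': "weight_ge \<nu> (Suc s) (g' - var2)"
    and 0: "residual H f g a = 0" "residual H f' g' a' = 0"
  shows "f = f'" "g = g'"
proof -
  have *: "weight_ge \<tau> (Suc s + n) (f - f') \<and> weight_ge \<nu> (Suc s + n) (g - g')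
      \<and> weight_ge \<nu> (Suc s + n) (phi_series a - phi_series a')" for n
  proof (induction n)
    \<comment> \<open>Both maps have the identity as leading part and \<open>phi_series\<close>
      starts in weight \<open>s + 1\<close>, so the induction starts there.\<close>
    case 0
    show ?case
      using weight_ge_diff[OF f f'] weight_ge_diff[OF g g']
        weight_ge_diff[OF weight_ge_phi_series weight_ge_phi_series, of a a']
      by simp
  next
    case (Suc n)
    define T where "T = linear_part s (f - f') (phi_series a - phi_series a')"
    have N: "s < Suc s + n" by simp
    note IH = conjunct1[OF Suc] conjunct1[OF conjunct2[OF Suc]] conjunct2[OF conjunct2[OF Suc]]
    have "weight_ge \<omega> (Suc (Suc s + n)) (residual H f g a - residual H f' g' a'
        - (\<sigma> (g - g' - T) - conj2 (\<sigma> T)))"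
      unfolding T_def by (intro weight_ge_residual_diff H f f' N IH)
    then have "weight_ge \<omega> (Suc (Suc s + n)) (- (\<sigma> (g - g' - T) - conj2 (\<sigma> T)))"
      by (simp only: 0 diff_self diff_0)
    then have "weight_ge \<omega> (Suc (Suc s + n)) (\<sigma> (g - g' - T) - conj2 (\<sigma> T))"
      using weight_ge_uminus by fastforce
    then show ?case
      using linearization_unique[OF N IH T_def] by simp
  qed
  have "weight_ge \<tau> n (f - f')" "weight_ge \<nu> n (g - g')" for n
    using *[of n] by (auto elim: weight_ge_mono)
  then have "f - f' = 0" "g - g' = 0" by (metis weight_ge_all_imp_0)+
  then show "f = f'" "g = g'" by simp_all
qed

text \<open>Subtracting a solution of the linearized equation cancels the weight-\<open>N\<close>
  part of the residual and leaves all lower weights of the data alone.\<close>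

lemma normalization_step:
  assumes H: "weight_ge \<omega> s H" "weight_ge \<omega> (Suc s) (H - model s)" and N: "s < N"
    and f: "weight_ge \<tau> (Suc s) (f - var1)" and g: "weight_ge \<nu> (Suc s) (g - var2)"
    and R: "weight_ge \<omega> N (residual H f g a)"
  obtains f' g' a' where "weight_ge \<tau> (Suc s) (f' - var1)" "weight_ge \<nu> (Suc s) (g' - var2)"
    "weight_ge \<omega> (Suc N) (residual H f' g' a')"
    "weight_ge \<tau> N (f' - f)" "weight_ge \<nu> N (g' - g)" "weight_ge \<nu> N (phi_series a' - phi_series a)"
proof -
  obtain df dg da T where d: "weight_ge \<tau> N df" "weight_ge \<nu> N dg" "weight_ge \<nu> N (phi_series da)"
    "T = linear_part s df (phi_series da)"
    "weight_ge \<omega> (Suc N) (residual H f g a - (\<sigma> (dg - T) - conj2 (\<sigma> T)))"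
    using linearization_surject[OF N R] by blast
  define a' where "a' = (\<lambda>n. a n - da n)"
  have a': "phi_series a - phi_series a' = phi_series da"
    by (rule series2_eqI) (simp add: phi_series_nth a'_def)
  have f': "weight_ge \<tau> (Suc s) (f - df - var1)"
    using weight_ge_diff[OF f weight_ge_mono[OF d(1)]] N by (simp add: algebra_simps)
  have g': "weight_ge \<nu> (Suc s) (g - dg - var2)"
    using weight_ge_diff[OF g weight_ge_mono[OF d(2)]] N by (simp add: algebra_simps)
  have "weight_ge \<omega> (Suc N) (residual H f g a - residual H (f - df) (g - dg) a'
      - (\<sigma> (g - (g - dg) - linear_part s (f - (f - df)) (phi_series a - phi_series a'))
         - conj2 (\<sigma> (linear_part s (f - (f - df)) (phi_series a - phi_series a')))))"
    by (rule weight_ge_residual_diff[OF H f f' N]) (simp_all only: a' diff_diff_eq2 add_diff_cancel_left' d)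
  then have "weight_ge \<omega> (Suc N) (residual H f g a - residual H (f - df) (g - dg) a'
      - (\<sigma> (dg - T) - conj2 (\<sigma> T)))"
    by (simp add: a' d(4))
  from weight_ge_diff[OF d(5) this]
  have "weight_ge \<omega> (Suc N) (residual H (f - df) (g - dg) a')" by simp
  moreover have "phi_series a' - phi_series a = - phi_series da"
    by (simp flip: a')
  ultimately show ?thesis
    using that[OF f' g'] d(1-3) weight_ge_uminus by simp
qed

lemma normalization_exists:
  assumes H: "weight_ge \<omega> s H" "weight_ge \<omega> (Suc s) (H - model s)"
  obtains f g a where "weight_ge \<tau> (Suc s) (f - var1)" "weight_ge \<nu> (Suc s) (g - var2)"
    "residual H f g a = 0"
proof -
  \<comment> \<open>The identity solves the equation to order \<open>s + 1\<close>, so the stages up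
    to \<open>s\<close> repeat it.\<close>
  define M where "M n = max n (Suc s)" for n
  define good where "good = (\<lambda>n (f, g, a). weight_ge \<tau> (Suc s) (f - var1)
    \<and> weight_ge \<nu> (Suc s) (g - var2) \<and> weight_ge \<omega> (M n) (residual H f g a))"
  define close where "close = (\<lambda>n (f, g, a) (f', g', a'). weight_ge \<tau> (M n) (f' - f)
    \<and> weight_ge \<nu> (M n) (g' - g) \<and> weight_ge \<nu> (M n) (phi_series a' - phi_series a))"
  have "good 0 (var1, var2, \<lambda>_. 0)"
  proof -
    have H0: "H $ 0 $ 0 = 0" by (rule weight_ge_nth_00[OF H(1)])
    have "phi_series (\<lambda>_. 0) = 0" by (rule series2_eqI) (simp add: phi_series_nth)
    then have "residual H var1 var2 (\<lambda>_. 0) = H - model s"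
      using residual_expand[of var1 H var1 var2 "\<lambda>_. 0"] H0
      by (simp add: conj2_power model_def)
    then show ?thesis using H by (simp add: good_def M_def)
  qed
  moreover have "\<exists>y. good (Suc n) y \<and> close n x y" if x: "good n x" for n x
  proof (cases "n \<le> s")
    case True
    then have "M (Suc n) = M n" by (simp add: M_def)
    then show ?thesis using x by (intro exI[of _ x]) (auto simp: good_def close_def)
  next
    case False
    obtain f g a where fga: "x = (f, g, a)" by (cases x)
    have M: "M n = n" "M (Suc n) = Suc n" using False by (auto simp: M_def)
    obtain f' g' a' where "weight_ge \<tau> (Suc s) (f' - var1)" "weight_ge \<nu> (Suc s) (g' - var2)"
      "weight_ge \<omega> (Suc n) (residual H f' g' a')"
      "weight_ge \<tau> n (f' - f)" "weight_ge \<nu> n (g' - g)" "weight_ge \<nu> n (phi_series a' - phi_series a)"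
      using normalization_step[OF H, of n f g a] False x by (auto simp: good_def fga M)
    then show ?thesis by (intro exI[of _ "(f', g', a')"]) (simp add: good_def close_def fga M)
  qed
  ultimately obtain X where X: "\<And>n. good n (X n)" "\<And>n. close n (X n) (X (Suc n))"
    using dependent_nat_choice[of good close] by blast
  define F where "F n = fst (X n)" for n
  define G where "G n = fst (snd (X n))" for n
  define A where "A n = snd (snd (X n))" for n
  have X_eq: "X n = (F n, G n, A n)" for n by (simp add: F_def G_def A_def)
  have good: "weight_ge \<tau> (Suc s) (F n - var1)" "weight_ge \<nu> (Suc s) (G n - var2)"
    "weight_ge \<omega> n (residual H (F n) (G n) (A n))" for n
    using X(1)[of n] weight_ge_mono[of _ "M n" _ n] by (auto simp: good_def X_eq M_def)
  have "weight_ge \<tau> n (F (Suc n) - F n)" "weight_ge \<nu> n (G (Suc n) - G n)"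
    "weight_ge \<nu> n (phi_series (A (Suc n)) - phi_series (A n))" for n
    using X(2)[of n] weight_ge_mono[of _ "M n" _ n] by (auto simp: close_def X_eq M_def)
  then obtain f g \<phi> where f: "\<And>n. weight_ge \<tau> n (f - F n)" and g: "\<And>n. weight_ge \<nu> n (g - G n)"
    and \<phi>: "\<And>n. weight_ge \<nu> n (\<phi> - phi_series (A n))"
    using weight_ge_limit[of \<tau> F] weight_ge_limit[of \<nu> G] weight_ge_limit[of \<nu> "\<lambda>n. phi_series (A n)"]
    by metis
  \<comment> \<open>Each coefficient of the limit is that of some \<open>phi_series\<close>, so the
    limit has the same form.\<close>
  define a where "a n = \<phi> $ n $ 0" for n
  have a: "phi_series a = \<phi>"
  proof (rule series2_eqI)
    fix i j
    have "\<phi> $ i $ j = phi_series (A (Suc (\<nu> i j))) $ i $ j"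
      using weight_geD[OF \<phi>, of i j "Suc (\<nu> i j)"] by simp
    then show "phi_series a $ i $ j = \<phi> $ i $ j"
      by (auto simp: phi_series_nth a_def)
  qed
  have f1: "weight_ge \<tau> (Suc s) (f - var1)"
    using weight_ge_add[OF f good(1), of "Suc s"] by simp
  have g1: "weight_ge \<nu> (Suc s) (g - var2)"
    using weight_ge_add[OF g good(2), of "Suc s"] by simp
  have "residual H f g a = 0"
  proof (rule weight_ge_all_imp_0)
    fix n
    define N where "N = Suc s + n"
    \<comment> \<open>The limit is compared with stage \<open>N\<close>: the first variation
      \<open>L\<close> and the residual of that stage both have order \<open>N\<close>.\<close>
    define L where "L = (let T = linear_part s (f - F N) (phi_series a - phi_series (A N)) in
        \<sigma> (g - G N - T) - conj2 (\<sigma> T))"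
    have "weight_ge \<omega> (Suc N) (residual H f g a - residual H (F N) (G N) (A N) - L)"
      unfolding L_def Let_def
      by (rule weight_ge_residual_diff[OF H f1 good(1)]) (use f g \<phi> a in \<open>auto simp: N_def\<close>)
    moreover have "weight_ge \<omega> N L"
      unfolding L_def Let_def a by (intro weight_ge_linearization f g \<phi>)
    ultimately have "weight_ge \<omega> N ((residual H f g a - residual H (F N) (G N) (A N) - L)
        + L + residual H (F N) (G N) (A N))"
      by (intro weight_ge_add good) (auto elim: weight_ge_mono)
    then show "weight_ge \<omega> n (residual H f g a)"
      by (auto simp: N_def elim: weight_ge_mono)
  qed
  then show ?thesis using that f1 g1 by blast
qed

text \<open>Only weights up to \<open>s\<close> matter. Expressed through the model, the equation in
  weight \<open>s\<close> forces \<open>\<alpha> ^ s = \<alpha> * cnj \<alpha>\<close>; since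
  \<open>\<alpha> \<noteq> 0\<close> and \<open>s > 2\<close>, moduli give
  \<open>cmod \<alpha> = 1\<close>.\<close>

lemma initial_jet:
  assumes H: "weight_ge \<omega> s H" "weight_ge \<omega> (Suc s) (H - model s)"
    and S: "formal_transformation (f, g)" and 0: "residual H f g a = 0"
  defines "\<alpha> \<equiv> f $ 1 $ 0"
  shows "cmod \<alpha> = 1" "\<alpha> ^ s = 1" "weight_ge \<tau> (Suc s) (f - const2 \<alpha> * var1)"
    "weight_ge \<nu> (Suc s) (g - var2)"
proof -
  have H0: "H $ 0 $ 0 = 0" by (rule weight_ge_nth_00[OF H(1)])
  have fg: "f $ 0 $ 0 = 0" "g $ 0 $ 0 = 0" "\<alpha> * g $ 0 $ 1 - f $ 0 $ 1 * g $ 1 $ 0 \<noteq> 0"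
    using S by (simp_all add: formal_transformation_def \<alpha>_def)
  define h where "h = f - const2 \<alpha> * var1"
  have h: "weight_ge \<tau> (Suc s) h"
    unfolding weight_ge_def
  proof (intro allI impI)
    fix i j assume "\<tau> i j < Suc s"
    then have "j = 0 \<and> i \<le> 1"
      using s3 by (cases j; cases i) (auto simp: tangential_weight_def split: if_splits)
    then show "h $ i $ j = 0"
      using fg(1) by (auto simp: h_def \<alpha>_def const2_mult_nth var1_nth le_Suc_eq simp del: fps_mult_nth_0 fps_mult_nth_1 fps_mult_nth_1')
  qed
  then show "weight_ge \<tau> (Suc s) (f - const2 \<alpha> * var1)" by (simp add: h_def)
  define P where "P = subst2 f var1 H"
  define Q where "Q = subst2 h var1 H"
  have P: "P = const2 \<alpha> * var1 + Q"
    by (simp add: P_def Q_def h_def subst2_diff subst2_mult H0)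
  obtain C C0 where C: "Q = var1\<^sup>2 * C + C0" "weight_ge \<omega> s C0"
    using tangential_square[OF h H(1)] unfolding Q_def by blast
  have z: "weight_ge \<omega> 1 var1" by (rule weight_ge_var) (simp add: surface_weight_def)
  have z\<zeta>2: "weight_ge \<omega> (Suc s) (var1 * var2\<^sup>2)"
    using weight_ge_monomial[of "Suc s" \<omega> 1 2] s3 by (simp add: surface_weight_def)
  have "weight_ge \<omega> 2 (var1\<^sup>2 * C)"
    by (intro weight_ge_mult_right weight_ge_var1_power) (auto simp: surface_weight_def)
  moreover have "weight_ge \<omega> 2 C0" using s3 by (intro weight_ge_mono[OF C(2)]) auto
  ultimately have Q2: "weight_ge \<omega> 2 Q" by (simp add: C(1) weight_ge_add)
  have \<alpha>z: "weight_ge \<omega> 1 (const2 \<alpha> * var1)" by (rule weight_ge_const2_mult[OF z])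
  have P1: "weight_ge \<omega> 1 P"
    unfolding P by (rule weight_ge_add[OF \<alpha>z weight_ge_mono[OF Q2]]) simp

  define e1 where "e1 = var1 * conj2 Q"
  have "weight_ge \<omega> (Suc s) (var1 * var2\<^sup>2 * conj2 C + var1 * conj2 C0)"
    by (intro weight_ge_add weight_ge_mult_right(1)[OF _ z\<zeta>2]
        weight_ge_mult[OF _ z weight_ge_conj2_surface_weight[OF C(2)]]) auto
  then have e1: "weight_ge \<omega> (Suc s) e1"
    by (simp add: e1_def C(1) conj2_add conj2_mult conj2_power algebra_simps)
  have e2: "weight_ge \<omega> (Suc s) (Q * conj2 Q)"
    using weight_ge_mult_conj2[OF h _ h H(1)] unfolding Q_def by (auto elim: weight_ge_mono)
  define e3 where "e3 = P ^ s - const2 (\<alpha> ^ s) * var1 ^ s + subst2 (phi_series a) P (model s)"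
  have "weight_ge \<omega> (Suc s) (P ^ s - (const2 \<alpha> * var1) ^ s)"
    by (rule weight_ge_power_diff[OF _ P1 \<alpha>z]) (use s3 P Q2 in auto)
  moreover have "weight_ge \<omega> (Suc s) (subst2 (phi_series a) P (model s))"
    by (rule subst2_weight[OF _ P1 weight_ge_model weight_ge_phi_series]) simp
  ultimately have e3: "weight_ge \<omega> (Suc s) e3"
    by (simp add: e3_def power_mult_distrib weight_ge_add)
  \<comment> \<open>\<open>W\<close> is the part of weight \<open>s\<close> of the right-hand
    side.\<close>
  define W where "W = const2 (\<alpha> * cnj \<alpha>) * (var1 * var2) + const2 (\<alpha> ^ s) * var1 ^ s
      + const2 (cnj \<alpha> ^ s) * var2 ^ s"
  have "P $ 0 $ 0 = 0" using weight_geD[OF P1, of 0 0] by (simp add: surface_weight_def)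
  then have "subst2 g var1 H = P * conj2 P + (P ^ s + subst2 (phi_series a) P (model s))
       + conj2 (P ^ s + subst2 (phi_series a) P (model s))"
    using residual_expand[OF P_def[symmetric], of g a] 0 by simp
  moreover have "P ^ s + subst2 (phi_series a) P (model s) = const2 (\<alpha> ^ s) * var1 ^ s + e3"
    by (simp add: e3_def)
  moreover have "P * conj2 P = const2 (\<alpha> * cnj \<alpha>) * (var1 * var2) + const2 \<alpha> * e1
      + conj2 (const2 \<alpha> * e1) + Q * conj2 Q"
    by (simp add: P e1_def conj2_add conj2_mult algebra_simps)
  ultimately have gW: "subst2 g var1 H - W =
      const2 \<alpha> * e1 + conj2 (const2 \<alpha> * e1) + Q * conj2 Q + e3 + conj2 e3"
    by (simp add: W_def conj2_add conj2_mult conj2_power)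
  then have gW: "weight_ge \<omega> (Suc s) (subst2 g var1 H - W)"
    using e1 e2 e3
    by (simp only: gW) (intro weight_ge_add weight_ge_conj2_surface_weight weight_ge_const2_mult)
  have W: "weight_ge \<omega> s W"
    using weight_ge_monomial[of s \<omega> 1 1] s3 unfolding W_def
    by (intro weight_ge_add weight_ge_const2_mult weight_ge_var1_power weight_ge_var2_power)
      (auto simp: surface_weight_def)
  have gH: "weight_ge \<omega> s (subst2 g var1 H)"
    using weight_ge_add[OF weight_ge_mono[OF gW] W] by simp
  \<comment> \<open>The restriction of \<open>g\<close> has order \<open>s\<close>, and uniqueness
    of the decomposition with zero conjugate component transfers this to \<open>g\<close>.\<close>
  have "weight_ge \<nu> n g" if "n \<le> s" for n
    using that
  proof (induction n)
    case (Suc n)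
    then have g: "weight_ge \<nu> n g" by simp
    have "weight_ge \<omega> (Suc n) (\<sigma> g)"
      using weight_ge_diff[OF weight_ge_mono[OF gH] weight_ge_subst2_graph_diff[OF g H]] Suc.prems
      by simp
    then show ?case using graded_decomposition_unique(1)[OF g, of 0] by simp
  qed simp
  then have g: "weight_ge \<nu> s g" by simp
  \<comment> \<open>Replacing \<open>z \<zeta>\<close> in \<open>W\<close> by the model minus the
    two pure powers leaves \<open>c\<close> as coefficient of \<open>z^s\<close> and its conjugate
    as that of \<open>\<zeta>^s\<close>.\<close>
  define c where "c = \<alpha> ^ s - \<alpha> * cnj \<alpha>"
  define G where "G = g - const2 (\<alpha> * cnj \<alpha>) * var2 - const2 c * var1 ^ s"
  define B where "B = const2 c * var1 ^ s"
  have Gs: "weight_ge \<nu> s G"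
    unfolding G_def
    by (intro weight_ge_diff g weight_ge_const2_mult weight_ge_var weight_ge_var1_power)
      (auto simp: lin_weight_def)
  have Bs: "weight_ge \<nu> s B"
    unfolding B_def by (intro weight_ge_const2_mult weight_ge_var1_power) (simp add: lin_weight_def)
  have B0: "B $ 0 = 0"
    using s3 by (simp add: B_def var1_def)
  have \<sigma>G: "\<sigma> G = \<sigma> g - const2 (\<alpha> * cnj \<alpha>) * model s - const2 c * var1 ^ s"
    by (simp add: G_def subst2_diff subst2_mult subst2_power)
  have \<sigma>B: "conj2 (\<sigma> B) = const2 (cnj c) * var2 ^ s"
    by (simp add: B_def subst2_mult subst2_power conj2_mult conj2_power)
  have "\<sigma> G - conj2 (\<sigma> B) = (subst2 g var1 H - W) - (subst2 g var1 H - \<sigma> g)"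
    unfolding \<sigma>G \<sigma>B by (simp add: W_def c_def model_def algebra_simps)
  then have "weight_ge \<omega> (Suc s) (\<sigma> G - conj2 (\<sigma> B))"
    using weight_ge_diff[OF gW weight_ge_subst2_graph_diff[OF g H]] by simp
  note GB = graded_decomposition_unique[OF Gs Bs B0 this]
  have "B $ s $ 0 = 0" by (rule weight_geD[OF GB(2)]) (simp add: lin_weight_def)
  moreover have "B $ s $ 0 = c" using monomial_nth[of c s 0 s 0] by (simp add: B_def)
  ultimately have c: "\<alpha> ^ s = \<alpha> * cnj \<alpha>" by (simp add: c_def)
  then have g': "weight_ge \<nu> (Suc s) (g - const2 (\<alpha> * cnj \<alpha>) * var2)"
    using GB(1) by (simp add: G_def c_def)
  \<comment> \<open>Without a term \<open>z\<close> in \<open>g\<close>, the nonzero Jacobian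
    requires \<open>\<alpha> \<noteq> 0\<close>.\<close>
  have "g $ 1 $ 0 = 0"
    using weight_geD[OF g', of 1 0] s3 unfolding fps_sub_nth const2_mult_nth
    by (simp add: lin_weight_def var2_nth)
  then have \<alpha>: "\<alpha> \<noteq> 0" using fg(3) by auto
  have "cmod \<alpha> ^ s = cmod \<alpha> ^ 2"
    using arg_cong[OF c, of cmod] by (simp add: norm_power norm_mult power2_eq_square)
  moreover have "s - 2 + 2 = s" using s3 by simp
  then have "cmod \<alpha> ^ s = cmod \<alpha> ^ (s - 2) * cmod \<alpha> ^ 2" by (metis power_add)
  ultimately have "cmod \<alpha> ^ (s - 2) = 1 ^ (s - 2)" using \<alpha> by simp
  then show norm: "cmod \<alpha> = 1"
    using s3 by (intro power_eq_imp_eq_base[of "cmod \<alpha>" "s - 2" 1]) auto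
  then have "\<alpha> * cnj \<alpha> = 1" by (simp flip: complex_norm_square)
  then show "\<alpha> ^ s = 1" "weight_ge \<nu> (Suc s) (g - var2)"
    using c g' by simp_all
qed

text \<open>The rotation fixes the product with the conjugate and the power \<open>s\<close>;
  dividing \<open>a n\<close> by \<open>c ^ n\<close> compensates it in
  \<open>\<phi>\<close>.\<close>

lemma residual_rotate:
  assumes H: "H $ 0 $ 0 = 0" and f: "f $ 0 $ 0 = 0" and c: "cmod c = 1" "c ^ s = 1"
  shows "residual H (const2 c * f) g (\<lambda>n. a n / c ^ n) = residual H f g a"
proof -
  define P where "P = subst2 f var1 H"
  have P0: "P $ 0 $ 0 = 0" using f by (simp add: P_def)
  have cP: "subst2 (const2 c * f) var1 H = const2 c * P"
    by (simp add: P_def subst2_mult H)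
  have cc: "c * cnj c = 1" using c(1) by (simp flip: complex_norm_square)
  have c0: "c \<noteq> 0" using c(1) by auto
  have "subst2 (phi_series (\<lambda>n. a n / c ^ n)) (const2 c * P) (model s) = subst2 (phi_series a) P (model s)"
  proof (rule series2_eqI)
    fix m n
    have "phi_series (\<lambda>n. a n / c ^ n) $ i $ j * ((const2 c * P) ^ i * model s ^ j) $ m $ n =
        phi_series a $ i $ j * (P ^ i * model s ^ j) $ m $ n" for i j
      using const2_mult_nth[of "c ^ i" "P ^ i * model s ^ j" m n] c0
      by (simp add: phi_series_nth power_mult_distrib mult.assoc)
    then show "subst2 (phi_series (\<lambda>n. a n / c ^ n)) (const2 c * P) (model s) $ m $ n =
        subst2 (phi_series a) P (model s) $ m $ n"
      by (simp add: subst2_nth)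
  qed
  moreover have "(const2 c * P) ^ s = P ^ s"
    using c(2) by (simp add: power_mult_distrib flip: const2_simps(7))
  moreover have "const2 c * P * conj2 (const2 c * P) = P * conj2 P"
  proof -
    have "const2 c * P * conj2 (const2 c * P) = const2 (c * cnj c) * (P * conj2 P)"
      by (simp add: conj2_mult)
    then show ?thesis by (simp add: cc)
  qed
  ultimately show ?thesis
    using residual_expand[OF P_def[symmetric] P0] residual_expand[OF cP] P0 by simp
qed

end

section \<open>The normal form theorem\<close>

theorem theorem1p1:
  fixes M :: surface and s :: nat
  assumes "bishop_surface M"
    and "bishop_invariant_zero M"
    and "s > 2"
    and "moser_invariant M s"
  shows "\<exists>F. normalizing M s F \<and>
           (\<forall>G. normalizing M s G \<longleftrightarrow>
              (\<exists>\<theta>::real. exp (\<i> * of_nat s * of_real \<theta>) = 1 \<and> G = map_compose (rotation \<theta>) F))"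
proof -
  have s3: "3 \<le> s" using assms(3) by simp
  have L: "formal_transformation (fst M)" and H: "weight_ge (lin_weight 1 1) 2 (snd M)"
    using assms(1)
    by (simp_all only: bishop_surface_def formal_surface_def linear_transformation_def terms_degree_ge_iff)
  obtain F\<^sub>0 E where F\<^sub>0: "formal_transformation F\<^sub>0" and E: "terms_degree_ge (s + 1) E"
    and F\<^sub>0M: "given_by F\<^sub>0 M (var1 * var2 + var1 ^ s + var2 ^ s + E)"
    using assms(4) unfolding moser_invariant_def by blast
  define K where "K = model s + E"
  define T where "T = map_compose F\<^sub>0 (fst M)"
  have preserves: "preserves_origin (fst M)" "preserves_origin F\<^sub>0"
    using L F\<^sub>0 by (simp_all add: formal_transformation_iff)
  have T: "formal_transformation T"
    using L F\<^sub>0 preserves by (simp add: T_def formal_transformation_map_compose_iff)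
  have TK: "maps_graph T (snd M) K"
    using F\<^sub>0M by (simp add: given_by_def T_def K_def model_def)
  \<comment> \<open>The surface weight is at least the degree, so the Moser remainder is already of
    higher weight.\<close>
  have "weight_ge (surface_weight s) (Suc s) E"
    using E by (auto simp: weight_ge_def terms_degree_ge_def surface_weight_def)
  then have K: "weight_ge (surface_weight s) s K" "weight_ge (surface_weight s) (Suc s) (K - model s)"
    using weight_ge_add[OF weight_ge_model[OF s3] weight_ge_mono, of "Suc s" E] by (simp_all add: K_def)
  have K2: "weight_ge (lin_weight 1 1) 2 K"
    unfolding weight_ge_2_iff
    using weight_geD[OF K(1)] s3 by (simp add: surface_weight_def)
  have NF0: "normal_form s a $ 0 $ 0 = 0" for a
    using s3 by (simp add: normal_form_def var1_def var2_def of_first_def normal_form_phi_def)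

  \<comment> \<open>Reduces normalizations of \<open>M\<close> to zeros of the residual on the
    prepared surface \<open>K\<close>.\<close>
  have key: "normalizing M s (map_compose S F\<^sub>0) \<longleftrightarrow>
      formal_transformation S \<and> (\<exists>a. residual s K (fst S) (snd S) a = 0)" if S: "preserves_origin S" for S
  proof -
    have "map_compose (map_compose S F\<^sub>0) (fst M) = map_compose S T"
      unfolding T_def by (rule map_compose_assoc[OF preserves(2,1)])
    then show ?thesis
      using formal_transformation_map_compose_iff[OF S F\<^sub>0]
        maps_graph_map_compose_iff[OF T S H K2 NF0 TK]
        maps_graph_iff_residual[OF s3, of "fst S" "snd S"]
      by (simp add: normalizing_def given_by_def)
  qed

  obtain f g a where fg: "weight_ge (tangential_weight s) (Suc s) (f - var1)"
      "weight_ge (lin_weight 1 s) (Suc s) (g - var2)" "residual s K f g a = 0"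
    using normalization_exists[OF s3 K] by blast
  have coeffs: "f $ 0 $ 0 = 0" "f $ 1 $ 0 = 1" "g $ 0 $ 0 = 0" "g $ 1 $ 0 = 0" "g $ 0 $ 1 = 1"
    using weight_geD[OF fg(1), of 0 0] weight_geD[OF fg(1), of 1 0] weight_geD[OF fg(2), of 0 0]
      weight_geD[OF fg(2), of 1 0] weight_geD[OF fg(2), of 0 1] s3
    by (simp_all add: tangential_weight_def lin_weight_def var1_nth var2_nth)
  define F where "F = map_compose (f, g) F\<^sub>0"

  have rotate: "map_compose (rotation \<theta>) F = map_compose (const2 (cis \<theta>) * f, g) F\<^sub>0" for \<theta>
    using preserves(2) coeffs(1,3)
    by (simp add: F_def map_compose_def rotation_def preserves_origin_def subst2_mult cis_conv_exp)
  have exp_eq: "exp (\<i> * of_nat s * of_real \<theta>) = cis \<theta> ^ s" for \<theta>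
    by (simp add: cis_conv_exp exp_of_nat_mult[symmetric] ac_simps)

  have "normalizing M s F"
    unfolding F_def using fg(3) coeffs
    by (subst key) (auto simp: preserves_origin_def formal_transformation_def)
  moreover have "\<exists>\<theta>::real. exp (\<i> * of_nat s * of_real \<theta>) = 1 \<and> G = map_compose (rotation \<theta>) F"
    if G: "normalizing M s G" for G
  proof -
    have "preserves_origin G"
      using G by (simp add: normalizing_def formal_transformation_iff)
    then obtain S where S: "preserves_origin S" "map_compose S F\<^sub>0 = G"
      using left_division[OF F\<^sub>0] by blast
    obtain f' g' where S_eq: "S = (f', g')" by (cases S)
    obtain b where b: "formal_transformation (f', g')" "residual s K f' g' b = 0"
      using key[OF S(1)] G S(2) by (auto simp: S_eq)
    define \<alpha> where "\<alpha> = f' $ 1 $ 0"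
    have \<alpha>: "cmod \<alpha> = 1" "\<alpha> ^ s = 1" and f': "weight_ge (tangential_weight s) (Suc s) (f' - const2 \<alpha> * var1)"
      and g': "weight_ge (lin_weight 1 s) (Suc s) (g' - var2)"
      using initial_jet[OF s3 K b] by (simp_all only: \<alpha>_def)
    \<comment> \<open>\<open>S\<close> is rotated back by its multiplier, so that its leading part
      is the identity and uniqueness applies.\<close>
    define c where "c = inverse \<alpha>"
    have "\<alpha> \<noteq> 0" using \<alpha>(1) by auto
    then have c: "cmod c = 1" "c ^ s = 1" "\<alpha> * c = 1" "c * \<alpha> = 1"
      using \<alpha> by (auto simp: c_def norm_inverse power_inverse)
    have c_\<alpha>: "const2 c * const2 \<alpha> = 1" "const2 \<alpha> * const2 c = 1"
      using c by (simp_all flip: const2_simps(4))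
    have "const2 c * (f' - const2 \<alpha> * var1) = const2 c * f' - var1"
      using c_\<alpha> by (simp add: right_diff_distrib flip: mult.assoc)
    then have cf': "weight_ge (tangential_weight s) (Suc s) (const2 c * f' - var1)"
      using weight_ge_const2_mult[OF f', of c] by simp
    have "f' $ 0 $ 0 = 0" using S(1) by (simp add: S_eq preserves_origin_def)
    then have "residual s K (const2 c * f') g' (\<lambda>n. b n / c ^ n) = 0"
      using residual_rotate[OF s3 _ _ c(1,2)] b(2) weight_ge_nth_00[OF s3 K(1)] by simp
    then have "f = const2 c * f'" "g = g'"
      using normalization_unique[OF s3 K fg(1) cf' fg(2) g' fg(3)] by blast+
    then have "f' = const2 \<alpha> * f" "g' = g"
      using c_\<alpha> by (simp_all flip: mult.assoc)
    moreover have "cis (Arg \<alpha>) = \<alpha>"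
      using \<alpha>(1) \<open>\<alpha> \<noteq> 0\<close> cis_Arg[of \<alpha>] by (simp add: sgn_eq)
    ultimately show ?thesis
      using S(2) \<alpha>(2) by (intro exI[of _ "Arg \<alpha>"]) (simp add: exp_eq rotate S_eq)
  qed
  moreover have "normalizing M s (map_compose (rotation \<theta>) F)"
    if "exp (\<i> * of_nat s * of_real \<theta>) = 1" for \<theta>
  proof -
    have c: "cis \<theta> ^ s = 1" using that by (simp only: exp_eq)
    have "residual s K (const2 (cis \<theta>) * f) g (\<lambda>n. a n / cis \<theta> ^ n) = 0"
      using residual_rotate[OF s3 weight_ge_nth_00[OF s3 K(1)] coeffs(1) _ c] fg(3) by simp
    moreover have "formal_transformation (const2 (cis \<theta>) * f, g)"
      unfolding formal_transformation_def fst_conv snd_conv const2_mult_nth coeffs by simp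
    ultimately show ?thesis
      unfolding rotate by (subst key) (auto simp: formal_transformation_iff)
  qed
  ultimately show ?thesis by blast
qed

end
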